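(* Let $g(t)=2/(1+t)$ and $g^*(z)=z\bigl(\psi(-z/2)-\psi((1-z)/2)\bigr)$. Suppose $\alpha_1>0$ is such that $g^*(z)\neq0$ for $\operatorname{Re}(z)<\alpha_1$. Let $(a_n)_{n\ge1}$ be a complex sequence with $A(x)=\sum_{n\le x}a_n$ and $A_g(x)=\sum_{n\le x}a_n\,g(n/x)$ for $x\ge1$. Let $\beta>0$, $c>0$, $\kappa\in\mathbb{C}$, and suppose $$A_g(x)=\kappa x^{-\beta}+O(x^{-c})\qquad(x\to\infty).$$ Set $\lambda=\min(c,\alpha_1)$. Then for every $\varepsilon>0$, $$A(x)=\begin{cases}\dfrac{\kappa}{g^*(\beta)}\,x^{-\beta}+O_\varepsilon(x^{-\lambda+\varepsilon}), & \beta<\alpha_1,\\[4pt] O_\varepsilon(x^{-\lambda+\varepsilon}), & \beta\ge\alpha_1.\end{cases}$$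
   Context: $\psi$ is the digamma function; $g^*$ is the meromorphic continuation of $-z\int_0^1 g(t)\,t^{-z-1}\,dt$ (defined for $\operatorname{Re} z<0$), with $g^*(0)=2$. *)

theory Defs
  imports "HOL-Complex_Analysis.Complex_Analysis"
begin

definition gker :: "real \<Rightarrow> real" where
  "gker t = 2 / (1 + t)"

text \<open>
  The singularity of the digamma expression at 0 is removable with value 2. The positive integers
  are genuine poles (see \<open>is_pole_gstar_iff\<close> below); there the value of \<open>gstar\<close> carries no meaning,
  because \<^const>\<open>Polygamma\<close> is totalised.
\<close>
definition gstar :: "complex \<Rightarrow> complex" where
  "gstar z = (if z = 0 then 2 else z * (Digamma (- z / 2) - Digamma ((1 - z) / 2)))"

definition summatory :: "(nat \<Rightarrow> complex) \<Rightarrow> real \<Rightarrow> complex" where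
  "summatory a x = (\<Sum>n = 1..nat \<lfloor>x\<rfloor>. a n)"

definition weighted_summatory :: "(real \<Rightarrow> real) \<Rightarrow> (nat \<Rightarrow> complex) \<Rightarrow> real \<Rightarrow> complex" where
  "weighted_summatory g a x = (\<Sum>n = 1..nat \<lfloor>x\<rfloor>. a n * complex_of_real (g (real n / x)))"

lemma gstar_expand:
  fixes z :: complex
  assumes "z \<notin> \<nat>"
  shows "gstar z = z * (Digamma (- z / 2 + of_nat m) - Digamma ((1 - z) / 2 + of_nat m)
           + (\<Sum>j<2*m. 2 * (-1) ^ j / (z - of_nat j)))"
proof -
  have ne: "z \<noteq> of_nat k" for k using assms by auto
  have z0: "z \<noteq> 0" using ne[of 0] by simp
  have 1: "- z / 2 \<noteq> - of_nat k" for k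
  proof
    assume "- z / 2 = - of_nat k"
    hence "z = of_nat (2 * k)" by (simp add: field_simps)
    with ne show False by blast
  qed
  have 2: "(1 - z) / 2 \<noteq> - of_nat k" for k
  proof
    assume "(1 - z) / 2 = - of_nat k"
    hence "z = of_nat (2 * k + 1)" by (simp add: field_simps)
    with ne show False by blast
  qed
  have s: "(\<Sum>j<2*m. 2 * (-1) ^ j / (z - of_nat j)) =
      (\<Sum>k<m. 1 / ((1 - z) / 2 + of_nat k)) - (\<Sum>k<m. 1 / (- z / 2 + of_nat k))"
  proof (induction m)
    case (Suc m)
    have "- z / 2 + of_nat m \<noteq> 0" using 1[of m] by (metis add_eq_0_iff2)
    hence a: "1 / (- z / 2 + of_nat m) = - (2 / (z - of_nat (2 * m)))"
      using ne[of "2*m"] by (simp add: divide_simps) (simp add: algebra_simps)?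
    have "(1 - z) / 2 + of_nat m \<noteq> 0" using 2[of m] by (metis add_eq_0_iff2)
    hence b: "1 / ((1 - z) / 2 + of_nat m) = - (2 / (z - of_nat (2 * m + 1)))"
      using ne[of "2*m+1"] by (simp add: divide_simps) (simp add: algebra_simps)?
    show ?case using Suc.IH a b by simp
  qed auto
  show ?thesis
    using z0 Polygamma_plus_of_nat[of m "- z / 2" 0] Polygamma_plus_of_nat[of m "(1 - z) / 2" 0] 1 2
    unfolding s by (simp add: gstar_def)
qed

lemma gstar_near_nat:
  obtains R where "isCont R (of_nat n)"
    "eventually (\<lambda>z. gstar z = z * R z + 2 * (-1) ^ n * z / (z - of_nat n)) (at (of_nat n))"
proof
  define m where "m = Suc n"
  define R where "R = (\<lambda>z. Digamma (- z / 2 + of_nat m) - Digamma ((1 - z) / 2 + of_nat m)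
           + (\<Sum>j\<in>{..<2*m}-{n}. 2 * (-1) ^ j / (z - of_nat j)) :: complex)"
  have "- of_nat n / 2 + of_nat m \<notin> (\<int>\<^sub>\<le>\<^sub>0 :: complex set)"
    "(1 - of_nat n) / 2 + of_nat m \<notin> (\<int>\<^sub>\<le>\<^sub>0 :: complex set)"
    by (auto elim!: nonpos_Ints_cases simp: complex_eq_iff m_def field_simps)
  thus "isCont R (of_nat n)"
    unfolding R_def by (intro continuous_intros) auto
  have "eventually (\<lambda>z. z \<in> ball (of_nat n :: complex) 1 - {of_nat n}) (at (of_nat n))"
    by (rule eventually_at_in_open) auto
  thus "eventually (\<lambda>z. gstar z = z * R z + 2 * (-1) ^ n * z / (z - of_nat n)) (at (of_nat n))"
  proof eventually_elim
    case (elim z)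
    have "z \<notin> \<nat>"
    proof
      assume "z \<in> \<nat>"
      then obtain k where k: "z = of_nat k" by (auto elim: Nats_cases)
      have "dist (of_nat n) (of_nat k :: complex) = \<bar>real n - real k\<bar>"
        unfolding dist_norm by (metis norm_of_real of_real_diff of_real_of_nat_eq)
      with elim k show False by auto
    qed
    moreover have "(\<Sum>j<2*m. 2 * (-1) ^ j / (z - of_nat j)) =
        2 * (-1) ^ n / (z - of_nat n) + (\<Sum>j\<in>{..<2*m}-{n}. 2 * (-1) ^ j / (z - of_nat j))"
      by (rule sum.remove) (auto simp: m_def)
    ultimately show ?case
      by (simp add: gstar_expand[of z m] R_def algebra_simps)
  qed
qed

lemma isCont_gstar_0: "isCont gstar 0"
proof -
  obtain R where R: "isCont R 0" "eventually (\<lambda>z. gstar z = z * R z + 2 * z / z) (at 0)"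
    using gstar_near_nat[of 0] by auto
  have "((\<lambda>z. z * R z + 2) \<longlongrightarrow> 0 * R 0 + 2) (at 0)"
    using R(1) by (intro tendsto_intros) (auto simp: isCont_def)
  moreover have "eventually (\<lambda>z. gstar z = z * R z + 2) (at 0)"
    using R(2) eventually_neq_at_within[of 0] by eventually_elim auto
  ultimately show ?thesis
    by (simp add: isCont_def gstar_def[of 0] tendsto_cong)
qed

lemma isCont_gstar:
  assumes "z \<notin> \<nat> - {0}"
  shows "isCont gstar z"
proof (cases "z = 0")
  case False
  hence z: "z \<notin> \<nat>" using assms by auto
  have 1: "- z / 2 \<notin> \<int>\<^sub>\<le>\<^sub>0"
  proof
    assume "- z / 2 \<in> \<int>\<^sub>\<le>\<^sub>0"
    then obtain k where "- z / 2 = - of_nat k" by (auto elim: nonpos_Ints_cases')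
    hence "z = of_nat (2 * k)" by (simp add: field_simps)
    with z show False by (metis of_nat_in_Nats)
  qed
  have 2: "(1 - z) / 2 \<notin> \<int>\<^sub>\<le>\<^sub>0"
  proof
    assume "(1 - z) / 2 \<in> \<int>\<^sub>\<le>\<^sub>0"
    then obtain k where "(1 - z) / 2 = - of_nat k" by (auto elim: nonpos_Ints_cases')
    hence "z = of_nat (2 * k + 1)" by (simp add: field_simps)
    with z show False by (metis of_nat_in_Nats)
  qed
  have "isCont (\<lambda>z. z * (Digamma (- z / 2) - Digamma ((1 - z) / 2))) z"
    using 1 2 by (intro continuous_intros) auto
  moreover have "eventually (\<lambda>z. gstar z = z * (Digamma (- z / 2) - Digamma ((1 - z) / 2))) (nhds z)"
    using t1_space_nhds[OF False] by eventually_elim (auto simp: gstar_def)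
  ultimately show ?thesis by (simp only: isCont_cong)
qed (use isCont_gstar_0 in simp)

lemma is_pole_gstar_iff: "is_pole gstar z \<longleftrightarrow> z \<in> \<nat> - {0}"
proof
  assume "is_pole gstar z"
  hence "filterlim gstar at_infinity (at z)" by (simp add: is_pole_def)
  hence "\<not> isCont gstar z"
    using not_tendsto_and_filterlim_at_infinity[of "at z" gstar] by (auto simp: isCont_def)
  thus "z \<in> \<nat> - {0}" using isCont_gstar by blast
next
  assume "z \<in> \<nat> - {0}"
  then obtain n where n: "z = of_nat n" "n > 0" by (auto elim!: Nats_cases)
  obtain R where R: "isCont R (of_nat n)"
    "eventually (\<lambda>z. gstar z = z * R z + 2 * (-1) ^ n * z / (z - of_nat n)) (at (of_nat n))"
    using gstar_near_nat .
  have "filterlim (\<lambda>z::complex. 2 * (-1) ^ n * z / (z - of_nat n)) at_infinity (at (of_nat n))"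
    by (rule filterlim_divide_at_infinity[where c = "2 * (-1) ^ n * of_nat n"])
       (use n in \<open>auto intro!: tendsto_eq_intros filterlim_atI simp: eventually_at_filter\<close>)
  moreover have "((\<lambda>z. z * R z) \<longlongrightarrow> of_nat n * R (of_nat n)) (at (of_nat n))"
    using R(1) by (intro tendsto_intros) (auto simp: isCont_def)
  ultimately have "filterlim (\<lambda>z. z * R z + 2 * (-1) ^ n * z / (z - of_nat n)) at_infinity (at (of_nat n))"
    by (intro tendsto_add_filterlim_at_infinity)
  thus "is_pole gstar z"
    unfolding is_pole_def n using filterlim_cong[OF refl refl R(2)] by blast
qed

lemma powr_has_integral_01:
  fixes s :: complex
  assumes "Re s > 0"
  shows "((\<lambda>t. of_real t powr (s - 1)) has_integral 1 / s) {0..1}"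
proof -
  have s: "s \<noteq> 0" using assms by auto
  have "((\<lambda>t. of_real t powr (s - 1)) has_integral
          (of_real 1 powr s / s - of_real 0 powr s / s)) {0..1}"
  proof (rule fundamental_theorem_of_calculus_interior)
    show "continuous_on {0..1} (\<lambda>t. complex_of_real t powr s / s)"
      using assms s by (intro continuous_intros) (auto simp: complex_nonneg_Reals_iff)
    fix t :: real assume t: "t \<in> {0<..<1}"
    have "((\<lambda>z. z powr s / s) has_field_derivative of_real t powr (s - 1)) (at (complex_of_real t))"
      using t s by (auto intro!: derivative_eq_intros simp: complex_nonpos_Reals_iff)
    from has_vector_derivative_real_field[OF this]
    show "((\<lambda>t. complex_of_real t powr s / s) has_vector_derivative of_real t powr (s - 1)) (at t)" .
  qed auto
  thus ?thesis using s by simp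
qed

text \<open>
  For \<open>Re z < 0\<close>, \<open>gstar\<close> is the integral transform of the kernel that the closed form continues.
\<close>
lemma gstar_eq_integral:
  fixes z :: complex
  assumes "Re z < 0"
  shows "(\<lambda>t. of_real (gker t) * of_real t powr (- z - 1)) integrable_on {0..1}"
    and "gstar z = - z * integral {0..1} (\<lambda>t. of_real (gker t) * of_real t powr (- z - 1))"
proof -
  define f where "f = (\<lambda>m t. (\<Sum>j<2*m. 2 * (-1) ^ j * of_real t powr ((of_nat j - z) - 1)) :: complex)"
  define F where "F = (\<lambda>t. if t = 1 then 0 else of_real (gker t) * of_real t powr (- z - 1) :: complex)"
  define D where "D = Digamma ((1 - z) / 2) - Digamma (- z / 2)"
  have f_int: "(f m has_integral (\<Sum>j<2*m. 2 * (-1) ^ j * (1 / (of_nat j - z)))) {0..1}" for m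
    unfolding f_def using assms
    by (intro has_integral_sum has_integral_mult_right powr_has_integral_01) auto
  have f_eq: "f m t = of_real (2 * (1 - t ^ (2 * m)) / (1 + t)) * of_real t powr (- z - 1)"
    if "t \<in> {0..1}" for m t
  proof (cases "t = 0")
    case True
    thus ?thesis by (simp add: f_def)
  next
    case False
    have p: "complex_of_real t powr ((of_nat j - z) - 1) = of_real t ^ j * of_real t powr (- z - 1)" for j
      using False powr_add[of "complex_of_real t" "of_nat j" "- z - 1"]
      by (simp add: powr_nat' algebra_simps)
    have "f m t = 2 * (\<Sum>j<2*m. (- of_real t) ^ j) * of_real t powr (- z - 1)"
      unfolding f_def p sum_distrib_left sum_distrib_right
      by (intro sum.cong refl) (simp add: power_minus[of "complex_of_real t"] mult.assoc)
    also have "(\<Sum>j<2*m. (- complex_of_real t) ^ j) = of_real (\<Sum>j<2*m. (- t) ^ j)" by simp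
    also have "(\<Sum>j<2*m. (- t) ^ j) = (1 - t ^ (2 * m)) / (1 + t)"
      using that by (subst sum_gp_strict) auto
    finally show ?thesis by simp
  qed
  have lim: "(\<lambda>m. f m t) \<longlonglongrightarrow> F t" if t: "t \<in> {0..1}" for t
  proof (cases "t = 1")
    case True
    thus ?thesis using f_eq[OF t] by (simp add: F_def)
  next
    case False
    hence "t ^ 2 < 1"
      using t by (auto simp: abs_square_less_1)
    hence "(\<lambda>m. of_real (2 * (1 - (t ^ 2) ^ m) / (1 + t)) * of_real t powr (- z - 1)) \<longlonglongrightarrow>
       complex_of_real (2 * (1 - 0) / (1 + t)) * of_real t powr (- z - 1)"
      using t by (intro tendsto_intros) auto
    thus ?thesis using f_eq[OF t] False by (simp add: F_def gker_def power_mult)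
  qed
  have bound: "norm (f m t) \<le> 2 * t powr (- Re z - 1)" if t: "t \<in> {0..1}" for m t
  proof -
    define u where "u = t ^ (2 * m)"
    have "u \<ge> 0" "u \<le> 1" using t by (auto simp: u_def intro: power_le_one)
    hence "\<bar>2 * (1 - u) / (1 + t)\<bar> \<le> 2"
      using t by (auto simp: divide_simps)
    hence "\<bar>2 * (1 - t ^ (2 * m)) / (1 + t)\<bar> \<le> 2"
      by (simp only: u_def)
    moreover have "norm (complex_of_real t powr (- z - 1)) = t powr (- Re z - 1)"
      using t by (subst norm_powr_real_powr) auto
    ultimately show ?thesis
      unfolding f_eq[OF t] norm_mult norm_of_real by (intro mult_mono) auto
  qed
  have h: "(\<lambda>t. 2 * t powr (- Re z - 1)) integrable_on {0..1}"
    using has_integral_powr_from_0[of "- Re z - 1" 1] assms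
    by (intro integrable_on_mult_right) (auto simp: integrable_on_def)
  have fi: "f m integrable_on {0..1}" for m using f_int by (auto simp: integrable_on_def)
  have F_int: "F integrable_on {0..1}"
    by (rule dominated_convergence(1)[OF fi h bound lim]) auto
  have F_lim: "(\<lambda>m. integral {0..1} (f m)) \<longlonglongrightarrow> integral {0..1} F"
    by (rule dominated_convergence(2)[OF fi h bound lim]) auto
  have "(\<lambda>m. integral {0..1} (f m)) \<longlonglongrightarrow> D"
  proof -
    have nz: "- z / 2 \<noteq> 0" "(1 - z) / 2 \<noteq> 0" using assms by auto
    have "(\<lambda>m. (of_real (ln (real m)) - (\<Sum>n<m. inverse ((1 - z) / 2 + of_nat n))) -
               (of_real (ln (real m)) - (\<Sum>n<m. inverse (- z / 2 + of_nat n)))) \<longlonglongrightarrow> D"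
      unfolding D_def by (intro tendsto_diff Digamma_LIMSEQ nz)
    moreover have "integral {0..1} (f m) =
        (of_real (ln (real m)) - (\<Sum>n<m. inverse ((1 - z) / 2 + of_nat n))) -
               (of_real (ln (real m)) - (\<Sum>n<m. inverse (- z / 2 + of_nat n)))" for m
    proof -
      have "(\<Sum>j<2*m. 2 * (-1) ^ j * (1 / (of_nat j - z))) =
         (\<Sum>n<m. inverse (- z / 2 + of_nat n)) - (\<Sum>n<m. inverse ((1 - z) / 2 + of_nat n))"
      proof (induction m)
        case (Suc m)
        have "- z / 2 + of_nat m = (of_nat (2 * m) - z) / 2"
          "(1 - z) / 2 + of_nat m = (of_nat (2 * m + 1) - z) / 2"
          by (simp_all add: field_simps)
        hence "inverse (- z / 2 + of_nat m) = 2 / (of_nat (2 * m) - z)"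
          "inverse ((1 - z) / 2 + of_nat m) = 2 / (of_nat (2 * m + 1) - z)"
          by (simp_all only: inverse_divide)
        thus ?case using Suc.IH by simp
      qed auto
      thus ?thesis using integral_unique[OF f_int[of m]] by simp
    qed
    ultimately show ?thesis by simp
  qed
  hence F_val: "integral {0..1} F = D" using F_lim LIMSEQ_unique by blast
  have spike: "of_real (gker t) * of_real t powr (- z - 1) = F t" if "t \<in> {0..1} - {1}" for t
    using that by (simp add: F_def)
  show "(\<lambda>t. of_real (gker t) * of_real t powr (- z - 1)) integrable_on {0..1}"
    by (rule integrable_spike[OF F_int, of "{1}"]) (use spike in auto)
  have "integral {0..1} (\<lambda>t. of_real (gker t) * of_real t powr (- z - 1)) = integral {0..1} F"
    by (rule integral_spike[of "{1}"]) (use spike in auto)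
  hence I: "integral {0..1} (\<lambda>t. of_real (gker t) * of_real t powr (- z - 1)) = D"
    using F_val by simp
  show "gstar z = - z * integral {0..1} (\<lambda>t. of_real (gker t) * of_real t powr (- z - 1))"
    unfolding I using assms by (auto simp: D_def gstar_def algebra_simps)
qed

end

theory Submission
  imports Defs
begin

text \<open>
  Put \<open>x = exp s\<close>, \<open>B s = A (exp s)\<close> and \<open>f s = A_g (exp s)\<close>. Partial summation turns the definition of
  \<open>A_g\<close> into the Volterra equation \<open>f = B + k * B\<close> with \<open>k s = 2 exp s / (1 + exp s)^2\<close> on \<open>s \<ge> 0\<close>, whose
  symbol is \<open>1 + (Laplace transform of k) (w) = gstar (- w)\<close>. The shift relation
  \<open>gstar (- w) = 2 - w / (w + 1) * gstar (- (w + 1))\<close> carries the expansion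
  \<open>gstar (- w) = 1 + 1 / (2 w) + O(1 / w^2)\<close> from \<open>Re w \<ge> 1\<close> to every right half-plane. Hence, for
  \<open>\<sigma> < \<alpha>\<^sub>1\<close>, the function \<open>1 / gstar (- w) - 1\<close> is holomorphic on \<open>Re w \<ge> - \<sigma>\<close> and, after removal of
  an elementary term of order \<open>1 / w\<close>, decays like \<open>1 / w^2\<close>; Cauchy's formula on large rectangles
  exhibits it as the Laplace transform of some \<open>r = O(exp (- \<sigma> s))\<close>. Uniqueness of Laplace transforms
  gives \<open>B = f + r * f\<close>, and the claim is read off by inserting \<open>f s = \<kappa> exp (- \<beta> s) + O(exp (- c s))\<close>.
\<close>

section \<open>Laplace transforms of functions of exponential order\<close>

text \<open>Nothing is assumed about the size of the coefficients, so the Laplace transform of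
  \<open>B\<close> is not known to converge at the outset. The Volterra equation itself supplies the
  growth bound: the total mass of \<open>k\<close> is \<open>g(0) - g(1) = 1\<close>, hence its mass
  on every bounded interval is smaller than 1. The main obstacle is that a zero-free half-plane
  alone does not produce a resolvent of size \<open>exp (- \<sigma> * s)\<close>. For this the line
  of inversion must be moved to \<open>Re w = - \<sigma>\<close>, and there uniform control for
  large imaginary part is needed. The term of order \<open>1 / w\<close> belongs to a jump of
  \<open>r\<close> at 0; it is not absolutely integrable on a vertical line and has to be
  transformed by hand. Poles of \<open>gstar\<close> at the positive integers turn into zeros of the
  reciprocal. They do not obstruct the shift when \<open>\<alpha>\<^sub>1 > 1\<close>, and they make
  the main term vanish when \<beta> is one of them. The loss of \<epsilon> has two sources: \<sigma>
  stays strictly below \<open>\<alpha>\<^sub>1\<close>, and convolving two functions of the same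
  exponential order may cost a factor \<open>s\<close>.\<close>

definition exp_order :: "real \<Rightarrow> (real \<Rightarrow> complex) \<Rightarrow> bool" where
  "exp_order a \<phi> \<longleftrightarrow> \<phi> \<in> borel_measurable borel \<and> (\<forall>s<0. \<phi> s = 0) \<and>
     (\<exists>C. \<forall>s\<ge>0. norm (\<phi> s) \<le> C * exp (a * s))"

text \<open>The value at 0 is kept, so a continuous function stays continuous on
  \<open>{0..}\<close> after the cut and can jump only at 0.\<close>

definition causal :: "(real \<Rightarrow> complex) \<Rightarrow> real \<Rightarrow> complex" where
  "causal \<phi> s = (if s < 0 then 0 else \<phi> s)"

definition laplace :: "(real \<Rightarrow> complex) \<Rightarrow> complex \<Rightarrow> complex" where
  "laplace \<phi> w = (\<integral>s. \<phi> s * exp (- w * of_real s) \<partial>lborel)"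

text \<open>For factors vanishing on the negative axis the integrand lives on \<open>{0..s}\<close>,
  so this is the Volterra convolution. Integrating over the whole line makes translation invariance
  and Fubini directly applicable.\<close>

definition conv :: "(real \<Rightarrow> complex) \<Rightarrow> (real \<Rightarrow> complex) \<Rightarrow> real \<Rightarrow> complex" where
  "conv \<phi> \<theta> s = (\<integral>t. \<phi> (s - t) * \<theta> t \<partial>lborel)"

lemma exp_orderD:
  assumes "exp_order a \<phi>"
  shows "\<phi> \<in> borel_measurable borel" "\<And>s. s < 0 \<Longrightarrow> \<phi> s = 0"
    and "\<exists>C\<ge>0. \<forall>s. norm (\<phi> s) \<le> C * exp (a * s)"
proof -
  obtain C where C: "\<And>s. s \<ge> 0 \<Longrightarrow> norm (\<phi> s) \<le> C * exp (a * s)"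
    using assms by (auto simp: exp_order_def)
  have "C \<ge> 0"
    using C[of 0] by (simp add: norm_ge_zero[THEN order_trans])
  moreover have "norm (\<phi> s) \<le> C * exp (a * s)" for s
    using C[of s] assms \<open>C \<ge> 0\<close> by (cases "s < 0") (auto simp: exp_order_def)
  ultimately show "\<exists>C\<ge>0. \<forall>s. norm (\<phi> s) \<le> C * exp (a * s)" by blast
qed (use assms in \<open>auto simp: exp_order_def\<close>)

lemma exp_order_mono:
  assumes "exp_order a \<phi>" "a \<le> b"
  shows "exp_order b \<phi>"
proof -
  obtain C where C: "C \<ge> 0" "\<And>s. norm (\<phi> s) \<le> C * exp (a * s)"
    using exp_orderD(3)[OF assms(1)] by blast
  have "norm (\<phi> s) \<le> C * exp (b * s)" if "s \<ge> 0" for s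
    using C(2)[of s] C(1) assms(2) that
    by (meson exp_le_cancel_iff mult_left_mono mult_right_mono order_trans)
  thus ?thesis using assms(1) by (auto simp: exp_order_def)
qed

lemma exp_order_add:
  assumes "exp_order a \<phi>" "exp_order a \<theta>"
  shows "exp_order a (\<lambda>s. \<phi> s + \<theta> s)"
proof -
  obtain C where C: "\<And>s. norm (\<phi> s) \<le> C * exp (a * s)" using exp_orderD(3)[OF assms(1)] by blast
  obtain D where D: "\<And>s. norm (\<theta> s) \<le> D * exp (a * s)" using exp_orderD(3)[OF assms(2)] by blast
  have "norm (\<phi> s + \<theta> s) \<le> (C + D) * exp (a * s)" for s
    using C[of s] D[of s] norm_triangle_ineq[of "\<phi> s" "\<theta> s"] by (simp add: algebra_simps)
  moreover have "(\<lambda>s. \<phi> s + \<theta> s) \<in> borel_measurable borel"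
    using assms by (auto simp: exp_order_def)
  ultimately show ?thesis using assms by (auto simp: exp_order_def)
qed

lemma exp_order_cmult:
  assumes "exp_order a \<phi>"
  shows "exp_order a (\<lambda>s. c * \<phi> s)"
proof -
  obtain C where C: "\<And>s. norm (\<phi> s) \<le> C * exp (a * s)" using exp_orderD(3)[OF assms] by blast
  have "norm (c * \<phi> s) \<le> (norm c * C) * exp (a * s)" for s
    using C[of s] by (simp add: norm_mult mult.assoc mult_left_mono)
  moreover have "(\<lambda>s. c * \<phi> s) \<in> borel_measurable borel"
    using assms by (auto simp: exp_order_def)
  ultimately show ?thesis using assms by (auto simp: exp_order_def)
qed

lemma exp_order_causal:
  assumes "continuous_on {0..} \<phi>" "\<And>s. s \<ge> 0 \<Longrightarrow> norm (\<phi> s) \<le> C * exp (a * s)"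
  shows "exp_order a (causal \<phi>)"
proof -
  have "(\<lambda>s. indicator {0..} s *\<^sub>R \<phi> s) \<in> borel_measurable borel"
    using assms(1) by (intro borel_measurable_continuous_on_indicator) auto
  also have "(\<lambda>s. indicator {0..} s *\<^sub>R \<phi> s) = causal \<phi>"
    by (auto simp: causal_def indicator_def fun_eq_iff)
  finally have "causal \<phi> \<in> borel_measurable borel" .
  thus ?thesis using assms(2) by (auto simp: exp_order_def causal_def)
qed

text \<open>Used with \<open>c = 0\<close> for the convergence of Laplace integrals and with
  \<open>c = s\<close> for the tail of the resolvent in the final estimate.\<close>

lemma has_bochner_integral_exp_tail:
  fixes b c :: real
  assumes "b > 0"
  shows "has_bochner_integral lborel (\<lambda>t. indicator {c..} t * exp (- b * t)) (exp (- b * c) / b)"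
proof -
  have "(\<integral>\<^sup>+t. ennreal (exp (- b * t)) * indicator {c..} t \<partial>lborel) = ennreal (0 - (- exp (- b * c) / b))"
  proof (rule nn_integral_FTC_atLeast)
    show "((\<lambda>t. - exp (- b * t) / b) has_real_derivative exp (- b * x)) (at x)" for x
      using assms by (auto intro!: derivative_eq_intros simp: field_simps)
    have "((\<lambda>t. - exp (- b * t) / b) \<longlongrightarrow> - 0 / b) at_top"
      using assms by (intro tendsto_intros filterlim_compose[OF exp_at_bot]
        filterlim_tendsto_neg_mult_at_bot[OF tendsto_const _ filterlim_ident]) auto
    thus "((\<lambda>t. - exp (- b * t) / b) \<longlongrightarrow> 0) at_top" by simp
  qed auto
  moreover have "(\<integral>\<^sup>+t. ennreal (exp (- b * t)) * indicator {c..} t \<partial>lborel) =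
     (\<integral>\<^sup>+t. ennreal (indicator {c..} t * exp (- b * t)) \<partial>lborel)"
    by (intro nn_integral_cong) (auto simp: indicator_def)
  ultimately show ?thesis using assms
    by (intro has_bochner_integral_nn_integral) auto
qed

lemma exp_order_integrable:
  assumes "exp_order a \<phi>" "Re w > a"
  shows "integrable lborel (\<lambda>s. \<phi> s * exp (- w * of_real s))"
proof -
  obtain C where C: "\<And>s. norm (\<phi> s) \<le> C * exp (a * s)" using exp_orderD(3)[OF assms(1)] by blast
  have "integrable lborel (\<lambda>s. C * (indicator {0..} s * exp (- (Re w - a) * s)))"
    using has_bochner_integral_exp_tail[of "Re w - a" 0] assms
    by (intro integrable_mult_right) (auto simp: has_bochner_integral_iff)
  thus ?thesis
  proof (rule Bochner_Integration.integrable_bound)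
    show "(\<lambda>s. \<phi> s * exp (- w * of_real s)) \<in> borel_measurable lborel"
      using exp_orderD(1)[OF assms(1)] by measurable
    have "norm (\<phi> s * exp (- w * of_real s)) \<le> norm (C * (indicator {0..} s * exp (- (Re w - a) * s)))" for s
    proof (cases "s < 0")
      case False
      have "norm (\<phi> s * exp (- w * of_real s)) \<le> C * exp (a * s) * exp (- Re w * s)"
        using C[of s] by (simp add: norm_mult)
      also have "\<dots> = C * (indicator {0..} s * exp (- (Re w - a) * s))"
        using False by (simp add: algebra_simps flip: exp_add)
      finally show ?thesis unfolding real_norm_def by linarith
    qed (use exp_orderD(2)[OF assms(1)] in auto)
    thus "AE s in lborel. norm (\<phi> s * exp (- w * of_real s)) \<le> norm (C * (indicator {0..} s * exp (- (Re w - a) * s)))"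
      by simp
  qed
qed

section \<open>Elementary rules for the Laplace transform\<close>

lemma laplace_add:
  assumes "exp_order a \<phi>" "exp_order a \<theta>" "Re w > a"
  shows "laplace (\<lambda>s. \<phi> s + \<theta> s) w = laplace \<phi> w + laplace \<theta> w"
  unfolding laplace_def distrib_right
  by (intro Bochner_Integration.integral_add exp_order_integrable[OF _ assms(3)] assms)

lemma laplace_cmult: "laplace (\<lambda>s. c * \<phi> s) w = c * laplace \<phi> w"
  unfolding laplace_def mult.assoc by simp

lemma norm_laplace_le:
  assumes "\<And>s. norm (\<phi> s) \<le> C" "\<And>s. s < 0 \<Longrightarrow> \<phi> s = 0" "Re w > 0" "\<phi> \<in> borel_measurable borel"
  shows "norm (laplace \<phi> w) \<le> C / Re w"
proof -
  have i: "has_bochner_integral lborel (\<lambda>t. C * (indicator {0..} t * exp (- Re w * t))) (C * (exp (- Re w * 0) / Re w))"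
    by (intro has_bochner_integral_mult_right has_bochner_integral_exp_tail assms)
  have "norm (laplace \<phi> w) \<le> (\<integral>t. C * (indicator {0..} t * exp (- Re w * t)) \<partial>lborel)"
    unfolding laplace_def
  proof (rule Bochner_Integration.integral_norm_bound_integral)
    have "exp_order 0 \<phi>" using assms by (auto simp: exp_order_def)
    thus "integrable lborel (\<lambda>s. \<phi> s * exp (- w * of_real s))"
      by (rule exp_order_integrable) (use assms in auto)
    show "norm (\<phi> s * exp (- w * of_real s)) \<le> C * (indicator {0..} s * exp (- Re w * s))" for s
      using assms(1,2)[of s] by (cases "s < 0") (auto simp: norm_mult intro: mult_right_mono)
  qed (use i in \<open>auto simp: has_bochner_integral_iff\<close>)
  thus ?thesis using i by (auto simp: has_bochner_integral_iff)
qed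

text \<open>Integration by parts. Differentiating on the whole line and cutting afterwards avoids
  one-sided derivatives; the jump created by the cut appears as the boundary term
  \<open>\<phi> 0\<close>.\<close>

lemma laplace_derivative:
  assumes deriv: "\<And>s. (\<phi> has_vector_derivative \<phi>' s) (at s)"
    and cont: "\<And>s. isCont \<phi>' s"
    and bd: "\<And>s. s \<ge> 0 \<Longrightarrow> norm (\<phi> s) \<le> C * exp (a * s)" "\<And>s. s \<ge> 0 \<Longrightarrow> norm (\<phi>' s) \<le> D * exp (a * s)"
    and w: "Re w > a"
  shows "laplace (causal \<phi>') w = w * laplace (causal \<phi>) w - \<phi> 0"
proof -
  define F where "F = (\<lambda>s. \<phi> s * exp (- w * of_real s))"
  define f where "f = (\<lambda>s. (\<phi>' s - w * \<phi> s) * exp (- w * of_real s))"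
  have contphi: "isCont \<phi> s" for s
    using deriv[of s] by (rule has_vector_derivative_continuous)
  have o: "exp_order a (causal \<phi>)" "exp_order a (causal \<phi>')"
    using contphi cont bd by (auto intro!: exp_order_causal continuous_at_imp_continuous_on)
  have int: "integrable lborel (\<lambda>s. causal \<phi> s * exp (- w * of_real s))"
    "integrable lborel (\<lambda>s. causal \<phi>' s * exp (- w * of_real s))"
    by (intro exp_order_integrable[OF _ w] o)+
  have eq: "indicator {0..} s *\<^sub>R f s = causal \<phi>' s * exp (- w * of_real s) - w * (causal \<phi> s * exp (- w * of_real s))" for s
    by (auto simp: f_def causal_def indicator_def algebra_simps)
  have sint: "set_integrable lborel {0..} f"
    unfolding set_integrable_def eq using int by auto
  have "(LBINT x=0..\<infinity>. f x) = 0 - \<phi> 0"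
  proof (rule interval_integral_FTC_integrable[where F = F])
    fix s
    have "((\<lambda>s. exp (- w * complex_of_real s)) has_vector_derivative - w * exp (- w * of_real s)) (at s)"
      by (rule has_vector_derivative_real_field) (auto intro!: derivative_eq_intros)
    from has_vector_derivative_mult[OF deriv[of s] this]
    show "(F has_vector_derivative f s) (at s)"
      by (simp add: F_def f_def algebra_simps)
    show "isCont f s" unfolding f_def using contphi cont by (intro continuous_intros) auto
  next
    show "set_integrable lborel (einterval 0 \<infinity>) f"
      by (rule set_integrable_subset[OF sint]) (auto simp: einterval_def zero_ereal_def)
    have "isCont F 0" unfolding F_def using contphi by (intro continuous_intros)
    hence "(F \<longlongrightarrow> F 0) (at_right 0)"
      by (simp add: continuous_at_imp_continuous_within continuous_within[symmetric])
    thus "((F \<circ> real_of_ereal) \<longlongrightarrow> \<phi> 0) (at_right 0)"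
      by (simp add: ereal_tendsto_simps zero_ereal_def F_def)
    have "(F \<longlongrightarrow> 0) at_top"
    proof (rule Lim_null_comparison)
      show "eventually (\<lambda>s. norm (F s) \<le> C * exp (- (Re w - a) * s)) at_top"
        using eventually_ge_at_top[of 0]
      proof eventually_elim
        case (elim s)
        have "norm (F s) \<le> C * exp (a * s) * exp (- Re w * s)"
          using bd(1)[OF elim] by (simp add: norm_mult F_def)
        thus ?case by (simp add: algebra_simps flip: exp_add)
      qed
      have "((\<lambda>s. C * exp (- (Re w - a) * s)) \<longlongrightarrow> C * 0) at_top"
        using w by (intro tendsto_intros filterlim_compose[OF exp_at_bot]
          filterlim_tendsto_neg_mult_at_bot[OF tendsto_const _ filterlim_ident]) auto
      thus "((\<lambda>s. C * exp (- (Re w - a) * s)) \<longlongrightarrow> 0) at_top" by simp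
    qed
    thus "((F \<circ> real_of_ereal) \<longlongrightarrow> 0) (at_left \<infinity>)" by (simp add: ereal_tendsto_simps)
  qed auto
  also have "(LBINT x=0..\<infinity>. f x) = (LBINT x:{0<..}. f x)"
    by (simp add: interval_lebesgue_integral_def zero_ereal_def einterval_eq)
  also have "\<dots> = (LBINT x:{0..}. f x)"
    unfolding set_lebesgue_integral_def
  proof (rule integral_cong_AE)
    show "(\<lambda>x. indicator {0<..} x *\<^sub>R f x) \<in> borel_measurable lborel"
      using set_integrable_subset[OF sint, of "{0<..}"] unfolding set_integrable_def
      by (intro borel_measurable_integrable) (simp add: subset_iff)
    show "(\<lambda>x. indicator {0..} x *\<^sub>R f x) \<in> borel_measurable lborel"
      using sint unfolding set_integrable_def by (rule borel_measurable_integrable)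
    show "AE x in lborel. indicator {0<..} x *\<^sub>R f x = indicator {0..} x *\<^sub>R f x"
      using AE_lborel_singleton[of 0] by eventually_elim (auto simp: indicator_def)
  qed
  also have "\<dots> = laplace (causal \<phi>') w - w * laplace (causal \<phi>) w"
    unfolding set_lebesgue_integral_def eq laplace_def using int by simp
  finally show ?thesis by (simp add: algebra_simps)
qed

text \<open>The exponential reproduces itself under differentiation, so integration by parts becomes
  the linear equation \<open>l * L = w * L - 1\<close> for its transform \<open>L\<close>.\<close>

lemma laplace_exp:
  assumes "Re w > Re l"
  shows "exp_order (Re l) (causal (\<lambda>s. exp (l * of_real s)))"
    and "laplace (causal (\<lambda>s. exp (l * of_real s))) w = 1 / (w - l)"
proof -
  let ?e = "\<lambda>s. exp (l * complex_of_real s)"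
  show "exp_order (Re l) (causal ?e)"
    by (rule exp_order_causal[where C = 1]) (auto intro!: continuous_intros)
  have "laplace (causal (\<lambda>s. l * ?e s)) w = w * laplace (causal ?e) w - ?e 0"
  proof (rule laplace_derivative[where C = 1 and D = "norm l" and a = "Re l"])
    show "(?e has_vector_derivative l * ?e s) (at s)" for s
      by (rule has_vector_derivative_real_field) (auto intro!: derivative_eq_intros)
  qed (use assms in \<open>auto simp: norm_mult intro!: continuous_intros\<close>)
  also have "causal (\<lambda>s. l * ?e s) = (\<lambda>s. l * causal ?e s)" by (auto simp: causal_def)
  finally have "(w - l) * laplace (causal ?e) w = 1" by (simp add: laplace_cmult algebra_simps)
  moreover have "w - l \<noteq> 0" using assms by auto
  ultimately show "laplace (causal ?e) w = 1 / (w - l)" by (simp add: field_simps)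
qed

section \<open>Convolution and Lerch's uniqueness theorem\<close>

lemma integrable_indicator_Icc: "integrable lborel (indicator {a..b::real} :: real \<Rightarrow> real)"
  by (intro integrable_real_indicator) (auto simp: emeasure_lborel_Icc_eq)

text \<open>Once both orders are raised to a common \<open>m\<close>, the product
  \<open>exp (m * (s - t)) * exp (m * t)\<close> no longer depends on \<open>t\<close>.\<close>

lemma conv_integrand_bound:
  assumes "exp_order a \<phi>" "exp_order b \<theta>" "a \<le> m" "b \<le> m"
  obtains K where "K \<ge> 0"
    "\<And>s t. norm (\<phi> (s - t) * \<theta> t) \<le> K * exp (m * s) * indicator {0..s} t"
proof -
  obtain C where C: "C \<ge> 0" "\<And>s. norm (\<phi> s) \<le> C * exp (m * s)"
    using exp_orderD(3)[OF exp_order_mono[OF assms(1,3)]] by blast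
  obtain D where D: "D \<ge> 0" "\<And>s. norm (\<theta> s) \<le> D * exp (m * s)"
    using exp_orderD(3)[OF exp_order_mono[OF assms(2,4)]] by blast
  have "norm (\<phi> (s - t) * \<theta> t) \<le> C * D * exp (m * s) * indicator {0..s} t" for s t
  proof (cases "t \<in> {0..s}")
    case True
    have "norm (\<phi> (s - t) * \<theta> t) \<le> (C * exp (m * (s - t))) * (D * exp (m * t))"
      unfolding norm_mult using C D by (intro mult_mono) auto
    also have "\<dots> = C * D * exp (m * s)" by (simp add: algebra_simps flip: exp_add)
    finally show ?thesis using True by simp
  next
    case False
    hence "t < 0 \<or> s - t < 0" by auto
    thus ?thesis using exp_orderD(2)[OF assms(1)] exp_orderD(2)[OF assms(2)] False by auto
  qed
  thus ?thesis using that[of "C * D"] C(1) D(1) by auto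
qed

lemma conv_integrable:
  assumes "exp_order a \<phi>" "exp_order b \<theta>"
  shows "integrable lborel (\<lambda>t. \<phi> (s - t) * \<theta> t)"
proof -
  define m where "m = max a b"
  obtain K where K: "K \<ge> 0"
    "\<And>s t. norm (\<phi> (s - t) * \<theta> t) \<le> K * exp (m * s) * indicator {0..s} t"
    by (rule conv_integrand_bound[OF assms, of m]) (auto simp: m_def)
  note [measurable] = exp_orderD(1)[OF assms(1)] exp_orderD(1)[OF assms(2)]
  have i: "integrable lborel (\<lambda>t. K * exp (m * s) * indicator {0..s} t :: real)"
    by (intro integrable_mult_right integrable_indicator_Icc)
  show ?thesis
    by (rule Bochner_Integration.integrable_bound[OF i])
       (use K in \<open>auto intro: order_trans[OF _ abs_ge_self]\<close>)
qed

text \<open>The order must be strictly larger than both given ones: integrating a constant bound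
  over \<open>{0..s}\<close> produces a factor \<open>s\<close>, which is absorbed through
  \<open>1 + x \<le> exp x\<close> with \<open>x = (d - m) * s\<close>.\<close>

lemma exp_order_conv:
  assumes "exp_order a \<phi>" "exp_order b \<theta>" "a < d" "b < d"
  shows "exp_order d (conv \<phi> \<theta>)"
proof -
  define m where "m = max a b"
  have m: "m < d" using assms by (auto simp: m_def)
  obtain K where K: "K \<ge> 0"
    "\<And>s t. norm (\<phi> (s - t) * \<theta> t) \<le> K * exp (m * s) * indicator {0..s} t"
    by (rule conv_integrand_bound[OF assms(1,2), of m]) (auto simp: m_def)
  note [measurable] = exp_orderD(1)[OF assms(1)] exp_orderD(1)[OF assms(2)]
  have "(\<lambda>s. \<integral>t. \<phi> (s - t) * \<theta> t \<partial>lborel) \<in> borel_measurable borel"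
    by measurable
  hence "conv \<phi> \<theta> \<in> borel_measurable borel" by (simp add: conv_def[abs_def])
  moreover have "norm (conv \<phi> \<theta> s) \<le> K / (d - m) * exp (d * s)" if "s \<ge> 0" for s
  proof -
    have "norm (conv \<phi> \<theta> s) \<le> (\<integral>t. K * exp (m * s) * indicator {0..s} t \<partial>lborel)"
      unfolding conv_def
      by (intro Bochner_Integration.integral_norm_bound_integral conv_integrable[OF assms(1,2)]
        integrable_mult_right integrable_indicator_Icc K(2))
    also have "\<dots> = K * exp (m * s) * s" using that by simp
    also have "\<dots> \<le> K * exp (m * s) * (exp ((d - m) * s) / (d - m))"
    proof (intro mult_left_mono)
      have "1 + (d - m) * s \<le> exp ((d - m) * s)" by (rule exp_ge_add_one_self)
      thus "s \<le> exp ((d - m) * s) / (d - m)" using m by (simp add: field_simps)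
    qed (use K in auto)
    also have "\<dots> = K / (d - m) * exp (d * s)" by (simp add: algebra_simps flip: exp_add)
    finally show ?thesis .
  qed
  moreover have "conv \<phi> \<theta> s = 0" if "s < 0" for s
  proof -
    have "\<phi> (s - t) * \<theta> t = 0" for t using K(2)[of s t] that by simp
    thus ?thesis unfolding conv_def by (simp only: Bochner_Integration.integral_zero)
  qed
  ultimately show ?thesis unfolding exp_order_def by blast
qed

text \<open>The weight splits as \<open>exp (- w * (s - t)) * exp (- w * t)\<close>, so the weighted
  factors are integrable and Fubini with translation invariance applies.\<close>

lemma laplace_conv:
  assumes "exp_order a \<phi>" "exp_order b \<theta>" "Re w > a" "Re w > b"
  shows "laplace (conv \<phi> \<theta>) w = laplace \<phi> w * laplace \<theta> w"
proof -
  define f where "f = (\<lambda>s. \<phi> s * exp (- w * of_real s))"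
  define g where "g = (\<lambda>s. \<theta> s * exp (- w * of_real s))"
  have f: "integrable lborel f" and g: "integrable lborel g"
    unfolding f_def g_def using assms exp_order_integrable by blast+
  have [measurable]: "f \<in> borel_measurable borel" "g \<in> borel_measurable borel"
    using borel_measurable_integrable[OF f] borel_measurable_integrable[OF g] by auto
  have tr: "integrable lborel (\<lambda>s. f (s - t))" "(\<integral>s. f (s - t) \<partial>lborel) = integral\<^sup>L lborel f"
    "(\<integral>s. norm (f (s - t)) \<partial>lborel) = (\<integral>s. norm (f s) \<partial>lborel)" for t
    using lborel_integrable_real_affine[OF f, of 1 "-t"] lborel_integral_real_affine[of 1 f "-t"]
      lborel_integral_real_affine[of 1 "\<lambda>s. norm (f s)" "-t"] by (simp_all add: algebra_simps)
  have int: "integrable (lborel \<Otimes>\<^sub>M lborel) (\<lambda>(t, s). f (s - t) * g t)"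
  proof (rule lborel_pair.Fubini_integrable)
    show "integrable lborel (\<lambda>t. \<integral>s. norm (case (t, s) of (t, s) \<Rightarrow> f (s - t) * g t) \<partial>lborel)"
      using g tr by (simp add: norm_mult)
    show "AE t in lborel. integrable lborel (\<lambda>s. case (t, s) of (t, s) \<Rightarrow> f (s - t) * g t)"
      using tr by simp
  qed measurable
  have "laplace (conv \<phi> \<theta>) w = (\<integral>s. (\<integral>t. f (s - t) * g t \<partial>lborel) \<partial>lborel)"
    unfolding laplace_def conv_def
  proof (intro Bochner_Integration.integral_cong refl)
    fix s :: real
    have "(\<integral>t. \<phi> (s - t) * \<theta> t \<partial>lborel) * exp (- w * of_real s) =
          (\<integral>t. \<phi> (s - t) * \<theta> t * exp (- w * of_real s) \<partial>lborel)"
      by (rule integral_mult_left_zero[symmetric])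
    also have "\<dots> = (\<integral>t. f (s - t) * g t \<partial>lborel)"
      by (intro Bochner_Integration.integral_cong refl)
         (simp add: f_def g_def algebra_simps flip: exp_add)
    finally show "(\<integral>t. \<phi> (s - t) * \<theta> t \<partial>lborel) * exp (- w * of_real s) = (\<integral>t. f (s - t) * g t \<partial>lborel)" .
  qed
  also have "\<dots> = (\<integral>t. (\<integral>s. f (s - t) * g t \<partial>lborel) \<partial>lborel)"
    using lborel_pair.Fubini_integral[OF int] by simp
  also have "\<dots> = laplace \<phi> w * laplace \<theta> w"
    using tr(2) by (simp add: laplace_def f_def g_def)
  finally show ?thesis .
qed

text \<open>Dominated convergence. The possible jump of \<phi> at 0 is met only at
  \<open>t = s\<close>, a null set. The second factor is merely measurable, which admits the step
  functions that occur later.\<close>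

lemma continuous_on_conv:
  assumes "exp_order a \<phi>" "exp_order b \<theta>" "continuous_on {0..} \<phi>"
  shows "continuous_on UNIV (conv \<phi> \<theta>)"
proof -
  obtain C where C: "C \<ge> 0" "\<And>s. norm (\<phi> s) \<le> C * exp (\<bar>a\<bar> * s)"
    using exp_orderD(3)[OF exp_order_mono[OF assms(1) abs_ge_self]] by blast
  obtain D where D: "D \<ge> 0" "\<And>s. norm (\<theta> s) \<le> D * exp (\<bar>b\<bar> * s)"
    using exp_orderD(3)[OF exp_order_mono[OF assms(2) abs_ge_self]] by blast
  note [measurable] = exp_orderD(1)[OF assms(1)] exp_orderD(1)[OF assms(2)]
  have cont: "isCont \<phi> u" if "u \<noteq> 0" for u
  proof (cases "u > 0")
    case True
    thus ?thesis using assms(3) continuous_on_interior[of "{0..}" \<phi> u] by simp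
  next
    case False
    hence "eventually (\<lambda>v. v \<in> {..<0}) (nhds u)"
      using that by (intro eventually_nhds_in_open) auto
    hence "eventually (\<lambda>v. \<phi> v = 0) (nhds u)"
      by eventually_elim (use exp_orderD(2)[OF assms(1)] in auto)
    thus ?thesis using isCont_cong[of \<phi> "\<lambda>_. 0" u] by simp
  qed
  have "(conv \<phi> \<theta> \<circ> X) \<longlonglongrightarrow> conv \<phi> \<theta> s" if X: "X \<longlonglongrightarrow> s" for X s
  proof -
    obtain S where S: "\<And>n. \<bar>X n\<bar> \<le> S"
      using convergent_imp_Bseq[of X] X by (auto simp: convergent_def Bseq_def)
    show ?thesis unfolding comp_def conv_def
    proof (rule integral_dominated_convergence[where w = "\<lambda>t. (C * exp (\<bar>a\<bar> * S) * (D * exp (\<bar>b\<bar> * S))) * indicator {0..S} t"])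
      show "AE t in lborel. (\<lambda>n. \<phi> (X n - t) * \<theta> t) \<longlonglongrightarrow> \<phi> (s - t) * \<theta> t"
        using AE_lborel_singleton[of s]
      proof eventually_elim
        case (elim t)
        have "(\<lambda>n. \<phi> (X n - t)) \<longlonglongrightarrow> \<phi> (s - t)"
          by (rule isCont_tendsto_compose[OF cont]) (use elim X in \<open>auto intro!: tendsto_intros\<close>)
        thus ?case by (intro tendsto_intros)
      qed
      show "AE t in lborel. norm (\<phi> (X n - t) * \<theta> t) \<le> (C * exp (\<bar>a\<bar> * S) * (D * exp (\<bar>b\<bar> * S))) * indicator {0..S} t" for n
      proof (rule AE_I2)
        fix t
        show "norm (\<phi> (X n - t) * \<theta> t) \<le> (C * exp (\<bar>a\<bar> * S) * (D * exp (\<bar>b\<bar> * S))) * indicator {0..S} t"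
        proof (cases "t < 0 \<or> X n - t < 0")
          case True
          thus ?thesis using exp_orderD(2)[OF assms(1)] exp_orderD(2)[OF assms(2)] C(1) D(1) by auto
        next
          case False
          have t: "0 \<le> t" "t \<le> S" "X n - t \<le> S" using False S[of n] by auto
          have "norm (\<phi> (X n - t)) \<le> C * exp (\<bar>a\<bar> * S)"
            by (rule order_trans[OF C(2)]) (use t C(1) in \<open>auto intro!: mult_left_mono\<close>)
          moreover have "norm (\<theta> t) \<le> D * exp (\<bar>b\<bar> * S)"
            by (rule order_trans[OF D(2)]) (use t D(1) in \<open>auto intro!: mult_left_mono\<close>)
          ultimately show ?thesis
            unfolding norm_mult using C D t by (auto intro!: mult_mono)
        qed
      qed
    qed (auto intro!: integrable_mult_right integrable_indicator_Icc simp del: integrable_mult_right_iff)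
  qed
  hence "isCont (conv \<phi> \<theta>) s" for s
    unfolding continuous_at_sequentially by (simp add: comp_def)
  thus ?thesis by (simp add: continuous_on_eq_continuous_at)
qed

text \<open>
  Substituting \<open>x = exp (- s)\<close>, all moments of a continuous function on \<open>[0, 1]\<close> vanish; by Weierstrass
  approximation it is then orthogonal to itself.
\<close>
lemma laplace_zero_imp_zero_real:
  fixes \<phi> :: "real \<Rightarrow> real"
  assumes cont: "continuous_on UNIV \<phi>" and neg: "\<And>s. s < 0 \<Longrightarrow> \<phi> s = 0"
    and bd: "\<And>s. \<bar>\<phi> s\<bar> \<le> C * exp (p * s)"
    and zero: "\<And>w. w > p \<Longrightarrow> (\<integral>s. \<phi> s * exp (- w * s) \<partial>lborel) = 0"
  shows "\<phi> s = 0"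
proof -
  \<comment> \<open>The damping leaves a decay like \<open>exp (- s)\<close>. The moment of order
    \<open>i\<close> becomes a value of the transform at \<open>p + 1 + i > p\<close>, and the
    function \<open>q\<close> below extends continuously by 0 to the origin.\<close>
  define \<psi> where "\<psi> = (\<lambda>s. \<phi> s * exp (- (p + 1) * s))"
  have C: "C \<ge> 0" using bd[of 0] by (auto intro: order_trans[OF abs_ge_zero])
  have \<psi>_bd: "\<bar>\<psi> s\<bar> \<le> C * exp (- s)" for s
  proof -
    have "\<bar>\<psi> s\<bar> \<le> (C * exp (p * s)) * exp (- (p + 1) * s)"
      unfolding \<psi>_def abs_mult using bd[of s] by (intro mult_mono) auto
    also have "\<dots> = C * exp (- s)" by (simp add: algebra_simps flip: exp_add)
    finally show ?thesis .
  qed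
  have \<psi>_cont: "continuous_on UNIV \<psi>" unfolding \<psi>_def by (intro continuous_intros cont)
  have \<psi>_neg: "\<psi> s = 0" if "s < 0" for s using neg[OF that] by (simp add: \<psi>_def)
  have [measurable]: "\<psi> \<in> borel_measurable borel"
    using \<psi>_cont by (rule borel_measurable_continuous_onI)
  have int: "integrable lborel (\<lambda>s. \<psi> s * g s)"
    if "g \<in> borel_measurable borel" "\<And>s. s \<ge> 0 \<Longrightarrow> \<bar>g s\<bar> \<le> K" for g K
  proof (rule Bochner_Integration.integrable_bound)
    show "integrable lborel (\<lambda>s. (C * K) * (indicator {0..} s * exp (- 1 * s)))"
      using has_bochner_integral_exp_tail[of 1 0] by (auto simp: has_bochner_integral_iff)
    show "(\<lambda>s. \<psi> s * g s) \<in> borel_measurable lborel" using that by measurable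
    have "norm (\<psi> s * g s) \<le> norm ((C * K) * (indicator {0..} s * exp (- 1 * s)))" for s
    proof (cases "s < 0")
      case False
      have "norm (\<psi> s * g s) \<le> (C * exp (- s)) * K"
        unfolding real_norm_def abs_mult
        by (rule mult_mono) (use \<psi>_bd[of s] that(2)[of s] False C in auto)
      also have "\<dots> = (C * K) * (indicator {0..} s * exp (- 1 * s))" using False by simp
      finally show ?thesis unfolding real_norm_def by linarith
    qed (use \<psi>_neg in auto)
    thus "AE s in lborel. norm (\<psi> s * g s) \<le> norm ((C * K) * (indicator {0..} s * exp (- 1 * s)))" by simp
  qed
  define q where "q = (\<lambda>x. if x = 0 then 0 else \<psi> (- ln x))"
  have q_bd: "\<bar>q x\<bar> \<le> C * x" if "x \<ge> 0" for x
    using \<psi>_bd[of "- ln x"] that by (auto simp: q_def)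
  have q_cont: "continuous_on {0..1} q"
  proof -
    have "(q \<longlongrightarrow> q x) (at x within {0..1})" if x: "x \<in> {0..1}" for x
    proof (cases "x = 0")
      case True
      have "(q \<longlongrightarrow> 0) (at 0 within {0..1})"
      proof (rule Lim_null_comparison)
        show "\<forall>\<^sub>F x in at 0 within {0..1}. norm (q x) \<le> C * x"
          using q_bd by (auto simp: eventually_at_filter)
        show "((\<lambda>x. C * x) \<longlongrightarrow> 0) (at 0 within {0..1})"
          by (auto intro!: tendsto_eq_intros)
      qed
      thus ?thesis using True by (simp add: q_def)
    next
      case False
      hence "isCont (\<lambda>x. \<psi> (- ln x)) x"
        using \<psi>_cont x by (intro isCont_o2[where g = \<psi> and f = "\<lambda>x. - ln x"] isCont_minus isCont_ln)
          (auto simp: continuous_on_eq_continuous_at)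
      moreover have "eventually (\<lambda>x. q x = \<psi> (- ln x)) (nhds x)"
        using t1_space_nhds[OF False] by eventually_elim (auto simp: q_def)
      ultimately have "isCont q x" by (simp add: isCont_cong)
      thus ?thesis by (simp add: continuous_at_imp_continuous_within continuous_within[symmetric])
    qed
    thus ?thesis by (simp add: continuous_on_def)
  qed
  have q_exp: "\<psi> s * q (exp (- s)) = (\<psi> s)\<^sup>2" for s
    by (simp add: q_def power2_eq_square)
  have poly: "(\<integral>s. \<psi> s * (\<Sum>i\<le>n. c i * exp (- s) ^ i) \<partial>lborel) = 0" for c :: "nat \<Rightarrow> real" and n
  proof -
    have i: "integrable lborel (\<lambda>s. \<psi> s * exp (- s) ^ i)" for i :: nat
      by (rule int[where K = 1]) (auto intro: power_le_one)
    have "(\<integral>s. \<psi> s * exp (- s) ^ i \<partial>lborel) = 0" for i :: nat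
    proof -
      have "\<psi> s * exp (- s) ^ i = \<phi> s * exp (- (p + 1 + real i) * s)" for s
        unfolding \<psi>_def exp_of_nat_mult[symmetric] mult.assoc exp_add[symmetric]
        by (simp add: algebra_simps)
      thus ?thesis using zero[of "p + 1 + real i"] by simp
    qed
    moreover have "(\<integral>s. \<psi> s * (\<Sum>i\<le>n. c i * exp (- s) ^ i) \<partial>lborel) =
        (\<integral>s. (\<Sum>i\<le>n. c i * (\<psi> s * exp (- s) ^ i)) \<partial>lborel)"
      by (simp add: sum_distrib_left algebra_simps)
    ultimately show ?thesis using i by (subst (asm) Bochner_Integration.integral_sum) auto
  qed
  define I where "I = (\<integral>s. (\<psi> s)\<^sup>2 \<partial>lborel)"
  define N where "N = (\<integral>s. \<bar>\<psi> s\<bar> \<partial>lborel)"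
  have N_int: "integrable lborel (\<lambda>s. \<bar>\<psi> s\<bar>)" using int[of "\<lambda>_. 1" 1] by simp
  have \<psi>_le: "\<bar>\<psi> s\<bar> \<le> C" for s
  proof (cases "s < 0")
    case False
    hence "C * exp (- s) \<le> C * 1" using C by (intro mult_left_mono) auto
    thus ?thesis using \<psi>_bd[of s] by linarith
  qed (use \<psi>_neg C in auto)
  have sq_int: "integrable lborel (\<lambda>s. (\<psi> s)\<^sup>2)"
    using int[of \<psi> C] \<psi>_le by (simp add: power2_eq_square)
  have "\<bar>I\<bar> \<le> e * N" if e: "e > 0" for e
  proof -
    obtain P where P: "real_polynomial_function P" "\<And>x. x \<in> {0..1} \<Longrightarrow> \<bar>q x - P x\<bar> < e"
      using Stone_Weierstrass_real_polynomial_function[OF _ q_cont e] by (auto simp: compact_Icc)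
    obtain c n where c: "P = (\<lambda>x. \<Sum>i\<le>n. c i * x ^ i)"
      using P(1) unfolding real_polynomial_function_iff_sum by blast
    have Pm [measurable]: "P \<in> borel_measurable borel" unfolding c by measurable
    have close: "\<bar>\<psi> s * (q (exp (- s)) - P (exp (- s)))\<bar> \<le> e * \<bar>\<psi> s\<bar>" for s
    proof (cases "s < 0")
      case False
      hence "\<bar>q (exp (- s)) - P (exp (- s))\<bar> \<le> e" using P(2)[of "exp (- s)"] by simp
      thus ?thesis unfolding abs_mult by (subst mult.commute) (rule mult_right_mono, auto)
    qed (use \<psi>_neg in auto)
    have P_int: "integrable lborel (\<lambda>s. \<psi> s * P (exp (- s)))"
    proof (rule int[where K = "C + e"])
      show "\<bar>P (exp (- s))\<bar> \<le> C + e" if "s \<ge> 0" for s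
      proof -
        have "C * exp (- s) \<le> C * 1" using C that by (intro mult_left_mono) auto
        moreover have "\<bar>q (exp (- s)) - P (exp (- s))\<bar> < e" using P(2)[of "exp (- s)"] that by simp
        moreover have "\<bar>q (exp (- s))\<bar> \<le> C * exp (- s)" by (rule q_bd) simp
        ultimately show ?thesis by linarith
      qed
    qed auto
    have "I = (\<integral>s. (\<psi> s)\<^sup>2 - \<psi> s * P (exp (- s)) \<partial>lborel)"
      using poly[of c n] P_int sq_int by (simp add: I_def c)
    also have "\<dots> = (\<integral>s. \<psi> s * (q (exp (- s)) - P (exp (- s))) \<partial>lborel)"
      by (simp add: right_diff_distrib q_exp)
    also have "\<bar>\<dots>\<bar> \<le> (\<integral>s. e * \<bar>\<psi> s\<bar> \<partial>lborel)"
      unfolding real_norm_def[symmetric]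
      by (rule Bochner_Integration.integral_norm_bound_integral)
         (use close N_int P_int sq_int in \<open>auto simp: right_diff_distrib q_exp\<close>)
    finally show ?thesis by (simp add: N_def)
  qed note I_le = this
  have "I = 0"
  proof (rule ccontr)
    assume "I \<noteq> 0"
    have N: "N \<ge> 0" by (simp add: N_def)
    \<comment> \<open>Using \<open>N + 1\<close> in the tolerance covers the case
      \<open>N = 0\<close>.\<close>
    have "\<bar>I\<bar> \<le> \<bar>I\<bar> / (2 * (N + 1)) * N" using I_le[of "\<bar>I\<bar> / (2 * (N + 1))"] N \<open>I \<noteq> 0\<close> by simp
    also have "\<dots> < \<bar>I\<bar>" using N \<open>I \<noteq> 0\<close> by (simp add: field_simps add_nonneg_pos)
    finally show False by simp
  qed
  hence "AE s in lborel. (\<psi> s)\<^sup>2 = 0"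
    using integral_nonneg_eq_0_iff_AE[OF sq_int] by (simp add: I_def)
  \<comment> \<open>The zero set of a continuous function is closed, and a closed set of full
    measure is the whole line; this passes from almost every \<open>s\<close> to every
    \<open>s\<close>.\<close>
  hence "AE s in lborel. s \<in> {s. \<psi> s = 0}" by simp
  moreover have "closed {s. \<psi> s = 0}"
    using continuous_closed_preimage_constant[OF \<psi>_cont closed_UNIV, of 0] by simp
  ultimately have "s \<in> {s. \<psi> s = 0}"
    using mem_closed_if_AE_lebesgue[of "{s. \<psi> s = 0}" s] by (auto intro: AE_completion)
  thus ?thesis by (simp add: \<psi>_def)
qed

text \<open>For real \<open>w\<close> the weight \<open>exp (- w * s)\<close> is real, so real and
  imaginary parts of the function have vanishing transforms separately.\<close>

lemma laplace_zero_imp_zero: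
  assumes cont: "continuous_on UNIV \<phi>" and ord: "exp_order p \<phi>"
    and zero: "\<And>w::real. w > p \<Longrightarrow> laplace \<phi> (of_real w) = 0"
  shows "\<phi> s = 0"
proof -
  obtain C where C: "\<And>s. norm (\<phi> s) \<le> C * exp (p * s)" using exp_orderD(3)[OF ord] by blast
  have int: "integrable lborel (\<lambda>s. \<phi> s * exp (- of_real w * of_real s))" if "w > p" for w
    using exp_order_integrable[OF ord, of "of_real w"] that by simp
  have "Re (\<phi> s) = 0"
  proof (rule laplace_zero_imp_zero_real[where \<phi> = "\<lambda>s. Re (\<phi> s)" and C = C and p = p])
    fix w assume w: "w > p"
    have "(\<integral>s. Re (\<phi> s) * exp (- w * s) \<partial>lborel) = (\<integral>s. Re (\<phi> s * exp (- of_real w * of_real s)) \<partial>lborel)"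
      by (intro Bochner_Integration.integral_cong) (auto simp: Re_exp Im_exp)
    also have "\<dots> = Re (laplace \<phi> (of_real w))" unfolding laplace_def by (rule integral_Re[OF int[OF w]])
    finally show "(\<integral>s. Re (\<phi> s) * exp (- w * s) \<partial>lborel) = 0" using zero[OF w] by simp
  qed (use exp_orderD(2)[OF ord] cont C in \<open>auto intro: continuous_intros order_trans[OF abs_Re_le_cmod]\<close>)
  moreover have "Im (\<phi> s) = 0"
  proof (rule laplace_zero_imp_zero_real[where \<phi> = "\<lambda>s. Im (\<phi> s)" and C = C and p = p])
    fix w assume w: "w > p"
    have "(\<integral>s. Im (\<phi> s) * exp (- w * s) \<partial>lborel) = (\<integral>s. Im (\<phi> s * exp (- of_real w * of_real s)) \<partial>lborel)"
      by (intro Bochner_Integration.integral_cong) (auto simp: Re_exp Im_exp)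
    also have "\<dots> = Im (laplace \<phi> (of_real w))" unfolding laplace_def by (rule integral_Im[OF int[OF w]])
    finally show "(\<integral>s. Im (\<phi> s) * exp (- w * s) \<partial>lborel) = 0" using zero[OF w] by simp
  qed (use exp_orderD(2)[OF ord] cont C in \<open>auto intro: continuous_intros order_trans[OF abs_Im_le_cmod]\<close>)
  ultimately show ?thesis by (simp add: complex_eq_iff)
qed

section \<open>Functions decaying in a half-plane are Laplace transforms\<close>

lemma integrable_inverse_1_plus_square: "integrable lborel (\<lambda>y::real. inverse (1 + y\<^sup>2))"
proof -
  have "set_integrable lborel (einterval (-\<infinity>) \<infinity>) (\<lambda>y::real. inverse (1 + y\<^sup>2))"
  proof (rule interval_integral_FTC_nonneg(1)[where F = arctan and A = "- (pi / 2)" and B = "pi / 2"])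
    show "((arctan \<circ> real_of_ereal) \<longlongrightarrow> - (pi / 2)) (at_right (-\<infinity>))"
      using tendsto_arctan_at_bot by (simp add: ereal_tendsto_simps)
    show "((arctan \<circ> real_of_ereal) \<longlongrightarrow> pi / 2) (at_left \<infinity>)"
      using tendsto_arctan_at_top by (simp add: ereal_tendsto_simps)
    show "isCont (\<lambda>y::real. inverse (1 + y\<^sup>2)) x" for x
      by (intro continuous_intros) (simp add: add_nonneg_eq_0_iff)
  qed (auto intro: DERIV_arctan)
  thus ?thesis by (simp add: set_integrable_def)
qed

text \<open>On a segment at distance at least \<open>T\<close> from the origin the numerator is at
  most \<open>C / T^2\<close> and the denominator at least 1; a length of at most
  \<open>2 * T\<close> then leaves a bound that tends to 0.\<close>

lemma contour_integral_linepath_decay_bound: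
  fixes F :: "complex \<Rightarrow> complex"
  assumes cont: "continuous_on (closed_segment p q) (\<lambda>v. F v / (v - w))" and C: "C \<ge> 0"
    and bd: "\<And>v. v \<in> closed_segment p q \<Longrightarrow> norm (F v) \<le> C / (1 + norm v ^ 2) \<and> norm v \<ge> T"
    and T: "T \<ge> norm w + 1" and len: "norm (q - p) \<le> 2 * T"
  shows "norm (contour_integral (linepath p q) (\<lambda>v. F v / (v - w))) \<le> 2 * C / T"
proof -
  have T0: "T > 0" using T norm_ge_zero[of w] by linarith
  have "norm (contour_integral (linepath p q) (\<lambda>v. F v / (v - w))) \<le> C / T ^ 2 * norm (q - p)"
  proof (rule contour_integral_bound_linepath)
    fix v assume v: "v \<in> closed_segment p q"
    have "norm (v - w) \<ge> 1" using bd[OF v] T norm_triangle_ineq2[of v w] by linarith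
    moreover have "norm (F v) \<le> C / T ^ 2"
    proof -
      have "norm v ^ 2 \<ge> T ^ 2" using bd[OF v] T0 by (intro power_mono) auto
      hence "T ^ 2 \<le> 1 + norm v ^ 2" by linarith
      hence "C / (1 + norm v ^ 2) \<le> C / T ^ 2"
        by (rule divide_left_mono) (use C T0 in \<open>simp_all add: add_pos_nonneg\<close>)
      thus ?thesis using bd[OF v] by linarith
    qed
    ultimately have "norm (F v) / norm (v - w) \<le> (C / T ^ 2) / 1"
      using C by (intro frac_le) auto
    thus "norm (F v / (v - w)) \<le> C / T ^ 2" by (simp add: norm_divide)
  qed (use cont C in \<open>auto intro: contour_integrable_continuous_linepath\<close>)
  also have "\<dots> \<le> C / T ^ 2 * (2 * T)" using C len by (intro mult_left_mono) auto
  also have "\<dots> = 2 * C / T" using T0 by (simp add: power2_eq_square)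
  finally show ?thesis .
qed

text \<open>Cauchy's formula on rectangles with left side on \<open>Re v = a\<close>, the other
  three sides being sent to infinity. The margin \<open>b < a\<close> puts the closed rectangle
  inside the domain of holomorphy. The kernel is written \<open>1 / (w - v)\<close> because this is
  the Laplace transform of \<open>exp (v * s)\<close> at \<open>w\<close>.\<close>

lemma Cauchy_half_plane:
  fixes F :: "complex \<Rightarrow> complex"
  assumes hol: "F holomorphic_on {v. Re v > b}" and ba: "b < a" and w: "Re w > a"
    and bd: "\<And>v. Re v \<ge> a \<Longrightarrow> norm (F v) \<le> C / (1 + norm v ^ 2)"
  shows "integrable lborel (\<lambda>y. F (Complex a y) / (w - Complex a y))"
    and "(\<integral>y. F (Complex a y) / (w - Complex a y) \<partial>lborel) = 2 * pi * F w"
proof -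
  define f where "f = (\<lambda>y. F (Complex a y) / (w - Complex a y))"
  define \<Phi> where "\<Phi> = (\<lambda>v. F v / (v - w))"
  have C: "C \<ge> 0"
  proof -
    have "0 \<le> C / (1 + norm (Complex a 0) ^ 2)"
      by (rule order_trans[OF norm_ge_zero bd]) simp
    moreover have "1 + norm (Complex a 0) ^ 2 > 0" by (intro add_pos_nonneg) auto
    ultimately show ?thesis by (simp add: zero_le_divide_iff)
  qed
  have contF: "continuous_on {v. Re v > b} F" using hol by (rule holomorphic_on_imp_continuous_on)
  have contf: "continuous_on UNIV f"
  proof -
    have 1: "continuous_on UNIV (\<lambda>y. Complex a y)" unfolding Complex_eq by (intro continuous_intros)
    hence 2: "continuous_on UNIV (\<lambda>y. F (Complex a y))"
      by (rule continuous_on_compose2[OF contF]) (use ba in auto)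
    show ?thesis unfolding f_def
      by (intro continuous_on_divide continuous_on_diff continuous_on_const 1 2) (use w in auto)
  qed
  have f_bd: "norm (f y) \<le> C / (Re w - a) * inverse (1 + y ^ 2)" for y
  proof -
    have "norm (F (Complex a y)) \<le> C * inverse (1 + y ^ 2)"
    proof -
      have "C / (1 + norm (Complex a y) ^ 2) \<le> C / (1 + y ^ 2)"
        using C by (intro divide_left_mono) (auto simp: cmod_def intro!: mult_pos_pos add_pos_nonneg)
      thus ?thesis using bd[of "Complex a y"] by (simp add: divide_inverse)
    qed
    moreover have "norm (w - Complex a y) \<ge> Re w - a"
      using complex_Re_le_cmod[of "w - Complex a y"] by simp
    ultimately have "norm (F (Complex a y)) / norm (w - Complex a y) \<le> C * inverse (1 + y ^ 2) / (Re w - a)"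
      using w C by (intro frac_le) auto
    thus ?thesis by (simp add: f_def norm_mult norm_inverse mult_ac divide_inverse)
  qed
  show f_int: "integrable lborel f"
  proof (rule Bochner_Integration.integrable_bound)
    show "integrable lborel (\<lambda>y. C / (Re w - a) * inverse (1 + y ^ 2))"
      by (intro integrable_mult_right integrable_inverse_1_plus_square)
    show "f \<in> borel_measurable lborel" using contf by (simp add: borel_measurable_continuous_onI)
    show "AE y in lborel. norm (f y) \<le> norm (C / (Re w - a) * inverse (1 + y ^ 2))"
      using f_bd by (intro AE_I2) (metis abs_ge_self order_trans real_norm_def)
  qed
  \<comment> \<open>The constant 6 counts three outer sides, each contributing at most
    \<open>2 * C / T\<close>. The lower bounds on \<open>T\<close> place \<open>w\<close> inside the
    rectangle, at distance at least 1 from these sides.\<close>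
  have est: "norm (integral {-T..T} f - 2 * pi * F w) \<le> 6 * C / T"
    if T: "T \<ge> norm w + 1" "T \<ge> \<bar>a\<bar> + 1" for T
  proof -
    have T0: "T > 0" using T by auto
    define a1 a2 a3 a4 where as: "a1 = Complex a (-T)" "a2 = Complex T (-T)" "a3 = Complex T T" "a4 = Complex a T"
    have rp: "rectpath a1 a3 = linepath a1 a2 +++ linepath a2 a3 +++ linepath a3 a4 +++ linepath a4 a1"
      by (simp add: rectpath_def as Let_def)
    have wbox: "w \<in> box a1 a3"
      using T w abs_Re_le_cmod[of w] abs_Im_le_cmod[of w] by (auto simp: in_box_complex_iff as)
    have aT: "a < T" using T by auto
    have segs: "closed_segment a1 a2 = {z. Im z = -T \<and> Re z \<in> {a..T}}"
      "closed_segment a2 a3 = {z. Re z = T \<and> Im z \<in> {-T..T}}"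
      "closed_segment a3 a4 = {z. Im z = T \<and> Re z \<in> {a..T}}"
      "closed_segment a4 a1 = {z. Re z = a \<and> Im z \<in> {-T..T}}"
      using T0 aT by (auto simp: as closed_segment_same_Re closed_segment_same_Im closed_segment_eq_real_ivl)
    have cont: "continuous_on A \<Phi>" if "A \<subseteq> {z. Re z \<ge> a} - {w}" for A
      unfolding \<Phi>_def using that ba
      by (intro continuous_intros continuous_on_subset[OF contF]) auto
    have wn: "Re w > a" "Re w < T" "Im w < T" "- T < Im w" using wbox by (auto simp: in_box_complex_iff as)
    have c: "continuous_on (closed_segment a1 a2) \<Phi>" "continuous_on (closed_segment a2 a3) \<Phi>"
      "continuous_on (closed_segment a3 a4) \<Phi>" "continuous_on (closed_segment a4 a1) \<Phi>"
      using wn aT T0 by (intro cont; auto simp: segs)+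
    have "(\<Phi> has_contour_integral (2 * pi * \<i> * winding_number (rectpath a1 a3) w * F w)) (rectpath a1 a3)"
      unfolding \<Phi>_def
    proof (rule Cauchy_integral_formula_convex_simple[OF _ hol])
      show "convex {v. Re v > b}" by (rule convex_halfspace_Re_gt)
      have "open {v. Re v > b}" by (rule open_halfspace_Re_gt)
      thus "w \<in> interior {v. Re v > b}" using w ba by (simp add: interior_open)
      show "path_image (rectpath a1 a3) \<subseteq> {v. b < Re v} - {w}"
        using wn aT T0 ba by (subst path_image_rectpath) (auto simp: as)
    qed auto
    hence "contour_integral (rectpath a1 a3) \<Phi> = 2 * pi * \<i> * F w"
      using winding_number_rectpath[OF wbox] by (simp add: contour_integral_unique)
    also have "contour_integral (rectpath a1 a3) \<Phi> = contour_integral (linepath a1 a2) \<Phi> +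
      (contour_integral (linepath a2 a3) \<Phi> + (contour_integral (linepath a3 a4) \<Phi> + contour_integral (linepath a4 a1) \<Phi>))"
      unfolding rp using c by (simp add: contour_integrable_continuous_linepath contour_integrable_joinI valid_path_join)
    \<comment> \<open>The left side is traversed downwards; the resulting sign cancels against the
      one between \<open>v - w\<close> and \<open>w - v\<close>.\<close>
    also have "contour_integral (linepath a4 a1) \<Phi> = - contour_integral (linepath a1 a4) \<Phi>"
      using c(4) by (subst contour_integral_reverse_linepath) auto
    also have "contour_integral (linepath a1 a4) \<Phi> = \<i> * integral {-T..T} (\<lambda>y. \<Phi> (Complex a y))"
      by (rule contour_integral_linepath_same_Re) (use T0 in \<open>auto simp: as\<close>)
    also have "(\<lambda>y. \<Phi> (Complex a y)) = (\<lambda>y. - f y)"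
      by (auto simp: \<Phi>_def f_def fun_eq_iff) (metis minus_diff_eq minus_divide_right)
    finally have eq: "integral {-T..T} f - 2 * pi * F w = \<i> * (contour_integral (linepath a1 a2) \<Phi> +
       contour_integral (linepath a2 a3) \<Phi> + contour_integral (linepath a3 a4) \<Phi>)"
      by (simp add: complex_eq_iff)
    have side: "norm (contour_integral (linepath p q) \<Phi>) \<le> 2 * C / T"
      if "continuous_on (closed_segment p q) \<Phi>" "norm (q - p) \<le> 2 * T"
        "closed_segment p q \<subseteq> closed_segment a1 a2 \<union> closed_segment a2 a3 \<union> closed_segment a3 a4" for p q
      unfolding \<Phi>_def
    proof (rule contour_integral_linepath_decay_bound[OF _ C _ T(1)])
      fix v assume "v \<in> closed_segment p q"
      hence "v \<in> closed_segment a1 a2 \<union> closed_segment a2 a3 \<union> closed_segment a3 a4" using that by blast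
      hence "Re v \<ge> a" "norm v \<ge> T"
        using T0 aT abs_Re_le_cmod[of v] abs_Im_le_cmod[of v] by (auto simp: segs)
      thus "norm (F v) \<le> C / (1 + norm v ^ 2) \<and> norm v \<ge> T" using bd by blast
    qed (use that in \<open>auto simp: \<Phi>_def\<close>)
    have "norm (contour_integral (linepath a1 a2) \<Phi>) \<le> 2 * C / T"
      by (rule side[OF c(1)]) (use T T0 in \<open>auto simp: as cmod_def real_sqrt_mult\<close>)
    moreover have "norm (contour_integral (linepath a2 a3) \<Phi>) \<le> 2 * C / T"
      by (rule side[OF c(2)]) (use T T0 in \<open>auto simp: as cmod_def real_sqrt_mult\<close>)
    moreover have "norm (contour_integral (linepath a3 a4) \<Phi>) \<le> 2 * C / T"
      by (rule side[OF c(3)]) (use T T0 in \<open>auto simp: as cmod_def real_sqrt_mult\<close>)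
    moreover have "6 * C / T = 2 * C / T + 2 * C / T + 2 * C / T" by simp
    ultimately show ?thesis unfolding eq norm_mult norm_ii mult_1
      using norm_triangle_ineq[of "contour_integral (linepath a1 a2) \<Phi> + contour_integral (linepath a2 a3) \<Phi>" "contour_integral (linepath a3 a4) \<Phi>"]
        norm_triangle_ineq[of "contour_integral (linepath a1 a2) \<Phi>" "contour_integral (linepath a2 a3) \<Phi>"]
      by linarith
  qed
  have lim1: "(\<lambda>n. integral {- real n..real n} f) \<longlonglongrightarrow> integral\<^sup>L lborel f"
  proof -
    have "(\<lambda>n. \<integral>y. indicator {- real n..real n} y *\<^sub>R f y \<partial>lborel) \<longlonglongrightarrow> integral\<^sup>L lborel f"
    proof (rule integral_dominated_convergence[where w = "\<lambda>y. norm (f y)"])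
      have "(\<lambda>n. indicator {- real n..real n} y *\<^sub>R f y) \<longlonglongrightarrow> f y" for y
      proof (rule tendsto_eventually)
        show "eventually (\<lambda>n. indicator {- real n..real n} y *\<^sub>R f y = f y) sequentially"
          using eventually_ge_at_top[of "nat \<lceil>\<bar>y\<bar>\<rceil>"]
        proof eventually_elim
          case (elim n)
          hence "y \<in> {- real n..real n}" by auto
          thus ?case by simp
        qed
      qed
      thus "AE y in lborel. (\<lambda>n. indicator {- real n..real n} y *\<^sub>R f y) \<longlonglongrightarrow> f y" by simp
    qed (use f_int borel_measurable_integrable[OF f_int] in \<open>auto simp: indicator_def\<close>)
    moreover have "(\<integral>y. indicator {- real n..real n} y *\<^sub>R f y \<partial>lborel) = integral {- real n..real n} f" for n
    proof -
      have "set_integrable lborel {- real n..real n} f"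
        unfolding set_integrable_def by (rule integrable_mult_indicator[OF _ f_int]) auto
      from set_borel_integral_eq_integral(2)[OF this] show ?thesis by (simp add: set_lebesgue_integral_def)
    qed
    ultimately show ?thesis by simp
  qed
  have "(\<lambda>n. integral {- real n..real n} f - 2 * pi * F w) \<longlonglongrightarrow> 0"
  proof (rule Lim_null_comparison)
    show "\<forall>\<^sub>F n in sequentially. norm (integral {- real n..real n} f - 2 * pi * F w) \<le> 6 * C / real n"
      using eventually_ge_at_top[of "nat \<lceil>norm w + 1 + (\<bar>a\<bar> + 1)\<rceil>"]
    proof eventually_elim
      case (elim n)
      hence "norm w + 1 + (\<bar>a\<bar> + 1) \<le> real n" by linarith
      hence "norm w + 1 \<le> real n" "\<bar>a\<bar> + 1 \<le> real n" using norm_ge_zero[of w] by linarith+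
      thus ?case by (rule est)
    qed
    show "(\<lambda>n. 6 * C / real n) \<longlonglongrightarrow> 0" by (rule lim_const_over_n)
  qed
  hence "(\<lambda>n. integral {- real n..real n} f) \<longlonglongrightarrow> 2 * pi * F w" by (rule LIM_zero_cancel)
  with lim1 show "(\<integral>y. f y \<partial>lborel) = 2 * pi * F w" using LIMSEQ_unique by blast
qed

text \<open>\<open>h\<close> is the inversion integral along \<open>Re v = a\<close>. Quadratic
  decay makes it absolutely convergent, which yields continuity and the order \<open>a\<close>
  without loss. By Fubini the transform of \<open>h\<close> is the integral evaluated in
  \<open>Cauchy_half_plane\<close>.\<close>

lemma laplace_surj_half_plane:
  fixes F :: "complex \<Rightarrow> complex"
  assumes hol: "F holomorphic_on {v. Re v > b}" and ba: "b < a"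
    and bd: "\<And>v. Re v \<ge> a \<Longrightarrow> norm (F v) \<le> C / (1 + norm v ^ 2)"
  obtains h where "continuous_on UNIV h" "exp_order a (causal h)"
    "\<And>w. Re w > a \<Longrightarrow> laplace (causal h) w = F w"
proof -
  define f where "f = (\<lambda>y. F (Complex a y))"
  define h where "h = (\<lambda>s. (\<integral>y. f y * exp (Complex a y * of_real s) \<partial>lborel) / (2 * pi))"
  have C: "C \<ge> 0"
  proof -
    have "0 \<le> C / (1 + norm (Complex a 0) ^ 2)"
      by (rule order_trans[OF norm_ge_zero bd]) simp
    moreover have "1 + norm (Complex a 0) ^ 2 > 0" by (intro add_pos_nonneg) auto
    ultimately show ?thesis by (simp add: zero_le_divide_iff)
  qed
  have contF: "continuous_on {v. Re v > b} F" using hol by (rule holomorphic_on_imp_continuous_on)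
  have contC: "continuous_on UNIV (\<lambda>y. Complex a y)" unfolding Complex_eq by (intro continuous_intros)
  hence contf: "continuous_on UNIV f"
    unfolding f_def using ba by (intro continuous_on_compose2[OF contF]) auto
  have [measurable]: "f \<in> borel_measurable borel" "(\<lambda>y. Complex a y) \<in> borel_measurable borel"
    using contf contC by (auto intro: borel_measurable_continuous_onI)
  have f_bd: "norm (f y) \<le> C * inverse (1 + y ^ 2)" for y
  proof -
    have "C / (1 + norm (Complex a y) ^ 2) \<le> C / (1 + y ^ 2)"
      using C by (intro divide_left_mono) (auto simp: cmod_def intro!: mult_pos_pos add_pos_nonneg)
    thus ?thesis using bd[of "Complex a y"] by (simp add: divide_inverse f_def)
  qed
  have f_int: "integrable lborel f"
  proof (rule Bochner_Integration.integrable_bound)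
    show "integrable lborel (\<lambda>y. C * inverse (1 + y ^ 2))"
      by (intro integrable_mult_right integrable_inverse_1_plus_square)
    show "AE y in lborel. norm (f y) \<le> norm (C * inverse (1 + y ^ 2))"
      using f_bd by (intro AE_I2) (metis abs_ge_self order_trans real_norm_def)
  qed auto
  have nfe: "norm (f y * exp (Complex a y * of_real s)) = norm (f y) * exp (a * s)" for y s
    by (simp add: norm_mult)
  have fe_int: "integrable lborel (\<lambda>y. f y * exp (Complex a y * of_real s))" for s
    by (rule Bochner_Integration.integrable_bound[of _ "\<lambda>y. norm (f y) * exp (a * s)"])
       (use f_int in \<open>auto simp: nfe\<close>)
  have h_cont: "continuous_on UNIV h"
  proof -
    have "isCont (\<lambda>s. \<integral>y. f y * exp (Complex a y * of_real s) \<partial>lborel) s" for s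
    proof (rule continuous_at_sequentiallyI)
      fix X :: "nat \<Rightarrow> real" assume X: "X \<longlonglongrightarrow> s"
      obtain S where S: "\<And>n. \<bar>X n\<bar> \<le> S"
        using convergent_imp_Bseq[of X] X by (auto simp: convergent_def Bseq_def)
      show "(\<lambda>n. \<integral>y. f y * exp (Complex a y * of_real (X n)) \<partial>lborel) \<longlonglongrightarrow> (\<integral>y. f y * exp (Complex a y * of_real s) \<partial>lborel)"
      proof (rule integral_dominated_convergence[where w = "\<lambda>y. norm (f y) * exp (\<bar>a\<bar> * S)"])
        show "AE y in lborel. (\<lambda>n. f y * exp (Complex a y * of_real (X n))) \<longlonglongrightarrow> f y * exp (Complex a y * of_real s)"
          by (intro AE_I2 tendsto_intros X)
        show "AE y in lborel. norm (f y * exp (Complex a y * of_real (X n))) \<le> norm (f y) * exp (\<bar>a\<bar> * S)" for n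
        proof (intro AE_I2)
          fix y
          have "a * X n \<le> \<bar>a\<bar> * \<bar>X n\<bar>" by (metis abs_ge_self abs_mult)
          also have "\<dots> \<le> \<bar>a\<bar> * S" using S[of n] by (intro mult_left_mono) auto
          finally show "norm (f y * exp (Complex a y * of_real (X n))) \<le> norm (f y) * exp (\<bar>a\<bar> * S)"
            unfolding nfe by (intro mult_left_mono) auto
        qed
      qed (use f_int in auto)
    qed
    thus ?thesis unfolding h_def by (intro continuous_intros) (auto simp: continuous_on_eq_continuous_at)
  qed
  have "exp_order a (causal h)"
  proof (rule exp_order_causal)
    fix s :: real
    have "norm (\<integral>y. f y * exp (Complex a y * of_real s) \<partial>lborel) \<le> (\<integral>y. norm (f y) * exp (a * s) \<partial>lborel)"
      by (rule Bochner_Integration.integral_norm_bound_integral) (use fe_int f_int in \<open>auto simp: norm_mult\<close>)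
    thus "norm (h s) \<le> (\<integral>y. norm (f y) \<partial>lborel) / (2 * pi) * exp (a * s)"
      by (simp add: h_def norm_divide norm_mult field_simps)
  qed (use h_cont continuous_on_subset in blast)
  moreover have "laplace (causal h) w = F w" if w: "Re w > a" for w
  proof -
    define e where "e = (\<lambda>y s. causal (\<lambda>s. exp (Complex a y * of_real s)) s * exp (- w * of_real s))"
    have e_val: "(\<integral>s. e y s \<partial>lborel) = 1 / (w - Complex a y)" for y
      using laplace_exp(2)[of "Complex a y" w] w by (simp add: laplace_def e_def)
    have e_int: "integrable lborel (e y)" for y
      unfolding e_def by (rule exp_order_integrable[OF laplace_exp(1)[where w = w]]) (use w in auto)
    have e_norm: "norm (e y s) = indicator {0..} s * exp (- (Re w - a) * s)" for y s
      by (auto simp: e_def causal_def norm_mult indicator_def algebra_simps simp flip: exp_add)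
    have en: "has_bochner_integral lborel (\<lambda>s. norm (e y s)) (1 / (Re w - a))" for y
      unfolding e_norm using has_bochner_integral_exp_tail[of "Re w - a" 0] w by simp
    have int: "integrable (lborel \<Otimes>\<^sub>M lborel) (\<lambda>(y, s). f y * e y s)"
    proof (rule lborel_pair.Fubini_integrable)
      show "(\<lambda>(y, s). f y * e y s) \<in> borel_measurable (lborel \<Otimes>\<^sub>M lborel)"
        unfolding e_def causal_def by measurable
      show "integrable lborel (\<lambda>y. \<integral>s. norm (case (y, s) of (y, s) \<Rightarrow> f y * e y s) \<partial>lborel)"
        using f_int en by (simp add: norm_mult has_bochner_integral_iff)
      show "AE y in lborel. integrable lborel (\<lambda>s. case (y, s) of (y, s) \<Rightarrow> f y * e y s)"
        using e_int by simp
    qed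
    have "causal h s * exp (- w * of_real s) = (\<integral>y. f y * e y s \<partial>lborel) / (2 * pi)" for s
    proof (cases "s < 0")
      case False
      have "(\<integral>y. f y * e y s \<partial>lborel) = (\<integral>y. f y * exp (Complex a y * of_real s) * exp (- w * of_real s) \<partial>lborel)"
        using False by (simp add: e_def causal_def mult_ac)
      also have "\<dots> = (\<integral>y. f y * exp (Complex a y * of_real s) \<partial>lborel) * exp (- w * of_real s)"
        by (rule integral_mult_left_zero)
      finally show ?thesis using False by (simp add: causal_def h_def)
    qed (simp add: causal_def e_def)
    hence "laplace (causal h) w = (\<integral>s. (\<integral>y. f y * e y s \<partial>lborel) / (2 * pi) \<partial>lborel)"
      unfolding laplace_def by presburger
    also have "\<dots> = (\<integral>s. (\<integral>y. f y * e y s \<partial>lborel) \<partial>lborel) / (2 * pi)" by simp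
    also have "(\<integral>s. (\<integral>y. f y * e y s \<partial>lborel) \<partial>lborel) = (\<integral>y. (\<integral>s. f y * e y s \<partial>lborel) \<partial>lborel)"
      by (rule lborel_pair.Fubini_integral[OF int])
    also have "\<dots> = (\<integral>y. F (Complex a y) / (w - Complex a y) \<partial>lborel)"
      by (simp add: e_val f_def)
    also have "\<dots> = 2 * pi * F w" by (rule Cauchy_half_plane[OF hol ba w bd])
    finally show ?thesis by simp
  qed
  ultimately show ?thesis using that[of h] h_cont by blast
qed

section \<open>The transform of the kernel\<close>

text \<open>Twice this function is \<open>gker (exp (- s))\<close>. The equation
  \<open>v' = v * (1 - v)\<close> makes every derivative a polynomial in \<open>v\<close>, so that
  \<open>0 < v < 1\<close> bounds them all.\<close>

definition logistic :: "real \<Rightarrow> real" where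
  "logistic s = 1 / (1 + exp (- s))"

text \<open>The derivative of \<open>gker (exp (- s))\<close>, cut at 0; in the variable
  \<open>t = exp (- s)\<close> it is \<open>- t * g'(t)\<close>, the weight arising in partial
  summation.\<close>

definition gconv_kernel :: "real \<Rightarrow> complex" where
  "gconv_kernel = causal (\<lambda>s. of_real (2 * logistic s * (1 - logistic s)))"

lemma logistic_bounds: "0 < logistic s" "logistic s < 1"
  by (simp_all add: logistic_def add_pos_pos)

lemma isCont_logistic [continuous_intros]: "isCont logistic s"
  unfolding logistic_def[abs_def] by (intro continuous_intros) (metis add_pos_pos exp_gt_zero less_irrefl zero_less_one)

lemma DERIV_logistic:
  "(logistic has_real_derivative logistic s * (1 - logistic s)) (at s)"
proof -
  have [simp]: "1 + exp (- s) \<noteq> 0" by (metis add_pos_pos exp_gt_zero less_irrefl zero_less_one)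
  have "((\<lambda>s. 1 / (1 + exp (- s))) has_real_derivative exp (- s) / (1 + exp (- s)) ^ 2) (at s)"
    by (auto intro!: derivative_eq_intros simp: power2_eq_square)
  also have "exp (- s) / (1 + exp (- s)) ^ 2 = logistic s * (1 - logistic s)"
    by (simp add: logistic_def power2_eq_square divide_simps)
  finally show ?thesis by (simp add: logistic_def[abs_def])
qed

lemma laplace_derivative_real:
  fixes r r' :: "real \<Rightarrow> real"
  assumes deriv: "\<And>s. (r has_real_derivative r' s) (at s)"
    and cont: "\<And>s. isCont r' s" and bd: "\<And>s. \<bar>r s\<bar> \<le> C" "\<And>s. \<bar>r' s\<bar> \<le> D" and w: "Re w > 0"
  shows "laplace (causal (\<lambda>s. of_real (r' s))) w = w * laplace (causal (\<lambda>s. of_real (r s))) w - of_real (r 0)"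
proof (rule laplace_derivative[where a = 0 and C = C and D = D])
  show "((\<lambda>s. complex_of_real (r s)) has_vector_derivative of_real (r' s)) (at s)" for s
    using deriv[of s] has_vector_derivative_of_real by (simp add: has_real_derivative_iff_has_vector_derivative)
  show "isCont (\<lambda>s. complex_of_real (r' s)) s" for s using cont by (intro continuous_intros)
qed (use bd w in auto)

text \<open>Expand \<open>2 / (1 + exp (- s))\<close> geometrically and transform term by term. Even
  and odd \<open>j\<close> form the sums in the limit formulas for \<open>Digamma\<close> at
  \<open>w / 2\<close> and \<open>(1 + w) / 2\<close>, whose logarithms cancel. With
  \<open>2 * m\<close> terms the partial sum is \<open>1 - exp (- s) ^ (2 * m)\<close> times the
  limit, so the limit itself serves as the dominating function.\<close>

lemma gstar_minus_eq_laplace_logistic: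
  assumes w: "Re w > 0"
  shows "gstar (- w) = w * laplace (causal (\<lambda>s. of_real (2 * logistic s))) w"
proof -
  define D where "D = Digamma ((1 + w) / 2) - Digamma (w / 2)"
  define e where "e = (\<lambda>j::nat. causal (\<lambda>s. exp (- of_nat j * complex_of_real s)))"
  define F where "F = (\<lambda>m s. \<Sum>j<2*m. 2 * (-1) ^ j * (e j s * exp (- w * of_real s)))"
  define G where "G = (\<lambda>s. causal (\<lambda>s. of_real (2 * logistic s)) s * exp (- w * of_real s))"
  have e_int: "integrable lborel (\<lambda>s. e j s * exp (- w * of_real s))" for j
  proof (rule exp_order_integrable)
    show "exp_order (Re (- of_nat j)) (e j)" unfolding e_def using w by (intro laplace_exp(1)[of _ w]) simp
  qed (use w in simp)
  have e_val: "(\<integral>s. e j s * exp (- w * of_real s) \<partial>lborel) = 1 / (w + of_nat j)" for j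
    using laplace_exp(2)[of "- of_nat j" w] w by (simp add: laplace_def e_def)
  have F_eq: "F m s = of_real (1 - exp (- s) ^ (2 * m)) * G s" for m s
  proof (cases "s < 0")
    case False
    have ne: "1 + exp (- s) \<noteq> 0" by (metis add_pos_pos exp_gt_zero less_irrefl zero_less_one)
    have "F m s = (\<Sum>j<2*m. 2 * of_real ((- exp (- s)) ^ j)) * exp (- w * of_real s)"
      unfolding F_def sum_distrib_right
    proof (intro sum.cong refl)
      fix j :: nat
      have "exp (- (of_nat j * complex_of_real s)) = of_real (exp (- s) ^ j)"
        by (simp flip: exp_of_real exp_of_nat_mult)
      thus "2 * (-1) ^ j * (e j s * exp (- w * of_real s)) = 2 * of_real ((- exp (- s)) ^ j) * exp (- w * of_real s)"
        using False by (simp add: e_def causal_def power_minus[of "exp (- s)"] power_minus[of "complex_of_real _"] mult_ac)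
    qed
    also have "(\<Sum>j<2*m. 2 * complex_of_real ((- exp (- s)) ^ j)) = of_real (2 * (\<Sum>j<2*m. (- exp (- s)) ^ j))"
      by (simp add: sum_distrib_left)
    also have "(\<Sum>j<2*m. (- exp (- s)) ^ j) = (1 - exp (- s) ^ (2 * m)) / (1 + exp (- s))"
    proof -
      have "- exp (- s) \<noteq> 1" using exp_gt_zero[of "- s"] by linarith
      thus ?thesis by (subst sum_gp_strict) auto
    qed
    finally show ?thesis using False by (simp add: G_def causal_def logistic_def)
  qed (simp add: F_def G_def e_def causal_def)
  have [measurable]: "G \<in> borel_measurable borel" 
    and G_int: "integrable lborel G"
  proof -
    have "exp_order 0 (causal (\<lambda>s. of_real (2 * logistic s)))"
      by (rule exp_order_causal[where C = 2])
         (use logistic_bounds in \<open>auto intro!: continuous_at_imp_continuous_on continuous_intros simp: less_imp_le\<close>)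
    thus "integrable lborel G" unfolding G_def using w by (rule exp_order_integrable)
    thus "G \<in> borel_measurable borel" using borel_measurable_integrable by force
  qed
  have "(\<lambda>m. integral\<^sup>L lborel (F m)) \<longlonglongrightarrow> integral\<^sup>L lborel G"
  proof (rule integral_dominated_convergence[where w = "\<lambda>s. norm (G s)"])
    show "AE s in lborel. (\<lambda>m. F m s) \<longlonglongrightarrow> G s"
      using AE_lborel_singleton[of 0]
    proof eventually_elim
      case (elim s)
      show ?case
      proof (cases "s < 0")
        case False
        hence "exp (- s) ^ 2 < 1" using elim by (simp flip: exp_of_nat_mult)
        hence "(\<lambda>m. of_real (1 - (exp (- s) ^ 2) ^ m) * G s) \<longlonglongrightarrow> of_real (1 - 0) * G s"
          by (intro tendsto_intros LIMSEQ_power_zero) auto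
        thus ?thesis by (simp add: F_eq power_mult)
      qed (simp add: F_eq G_def causal_def)
    qed
    show "AE s in lborel. norm (F m s) \<le> norm (G s)" for m
    proof (intro AE_I2)
      fix s
      show "norm (F m s) \<le> norm (G s)"
      proof (cases "s < 0")
        case False
        define u where "u = exp (- s) ^ (2 * m)"
        have "u \<ge> 0" "u \<le> 1" using False by (auto simp: u_def intro: power_le_one)
        hence "norm (of_real (1 - u) :: complex) \<le> 1" unfolding norm_of_real by linarith
        hence "norm (of_real (1 - u) * G s) \<le> 1 * norm (G s)" unfolding norm_mult by (intro mult_right_mono) auto
        thus ?thesis by (simp add: F_eq u_def)
      qed (simp add: F_eq G_def causal_def)
    qed
    show "F m \<in> borel_measurable lborel" for m
      unfolding F_eq[abs_def] by measurable
  qed (use G_int in auto)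
  moreover have "(\<lambda>m. integral\<^sup>L lborel (F m)) \<longlonglongrightarrow> D"
  proof -
    have "w / 2 \<noteq> 0" "(1 + w) / 2 \<noteq> 0" using w by (auto simp: complex_eq_iff)
    hence "(\<lambda>m. (of_real (ln (real m)) - (\<Sum>n<m. inverse ((1 + w) / 2 + of_nat n))) -
               (of_real (ln (real m)) - (\<Sum>n<m. inverse (w / 2 + of_nat n)))) \<longlonglongrightarrow> D"
      unfolding D_def by (intro tendsto_diff Digamma_LIMSEQ)
    moreover have "integral\<^sup>L lborel (F m) = (\<Sum>n<m. inverse (w / 2 + of_nat n)) - (\<Sum>n<m. inverse ((1 + w) / 2 + of_nat n))" for m
    proof -
      have "integral\<^sup>L lborel (F m) = (\<Sum>j<2*m. 2 * (-1) ^ j * (1 / (w + of_nat j)))"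
        unfolding F_def e_val[symmetric]
        by (subst Bochner_Integration.integral_sum) (use e_int in \<open>auto intro!: integrable_mult_right\<close>)
      also have "\<dots> = (\<Sum>n<m. inverse (w / 2 + of_nat n)) - (\<Sum>n<m. inverse ((1 + w) / 2 + of_nat n))"
      proof (induction m)
        case (Suc m)
        have "w / 2 + of_nat m = (w + of_nat (2 * m)) / 2"
          "(1 + w) / 2 + of_nat m = (w + of_nat (2 * m + 1)) / 2"
          by (simp_all add: field_simps)
        hence "inverse (w / 2 + of_nat m) = 2 / (w + of_nat (2 * m))"
          "inverse ((1 + w) / 2 + of_nat m) = 2 / (w + of_nat (2 * m + 1))"
          by (simp_all only: inverse_divide)
        thus ?case using Suc.IH by simp
      qed auto
      finally show ?thesis .
    qed
    ultimately show ?thesis by simp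
  qed
  ultimately have "integral\<^sup>L lborel G = D" using LIMSEQ_unique by blast
  hence L: "laplace (causal (\<lambda>s. of_real (2 * logistic s))) w = D" by (simp add: G_def laplace_def)
  show ?thesis unfolding L using w by (auto simp: gstar_def D_def algebra_simps)
qed

lemma exp_order_gconv_kernel: "exp_order 0 gconv_kernel"
  unfolding gconv_kernel_def
proof (rule exp_order_causal[where C = 2])
  show "continuous_on {0..} (\<lambda>s. complex_of_real (2 * logistic s * (1 - logistic s)))"
    by (intro continuous_at_imp_continuous_on ballI continuous_intros)
  show "norm (complex_of_real (2 * logistic s * (1 - logistic s))) \<le> 2 * exp (0 * s)" for s
    unfolding norm_of_real using logistic_bounds[of s] by (auto simp: abs_mult intro!: mult_le_one)
qed

text \<open>Integration by parts in the preceding formula; the boundary value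
  \<open>2 * logistic 0 = 1\<close> becomes the constant term, which represents the identity in the
  Volterra operator.\<close>

lemma gstar_minus_eq_laplace:
  assumes "Re w > 0"
  shows "gstar (- w) = 1 + laplace gconv_kernel w"
proof -
  have "laplace gconv_kernel w = w * laplace (causal (\<lambda>s. of_real (2 * logistic s))) w - of_real (2 * logistic 0)"
    unfolding gconv_kernel_def
  proof (rule laplace_derivative_real[where C = 2 and D = 2])
    show "((\<lambda>s. 2 * logistic s) has_real_derivative 2 * logistic s * (1 - logistic s)) (at s)" for s
      by (auto intro!: derivative_eq_intros DERIV_logistic)
    show "isCont (\<lambda>s. 2 * logistic s * (1 - logistic s)) s" for s by (intro continuous_intros)
    show "\<bar>2 * logistic s * (1 - logistic s)\<bar> \<le> 2" "\<bar>2 * logistic s\<bar> \<le> 2" for s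
      using logistic_bounds[of s] by (auto simp: abs_mult intro!: mult_le_one)
  qed (rule assms)
  thus ?thesis by (simp add: gstar_minus_eq_laplace_logistic[OF assms] logistic_def)
qed

text \<open>Two further integrations by parts. The kernel has value \<open>1 / 2\<close> and
  derivative 0 at the origin, which accounts for the term \<open>1 / (2 * w)\<close> and for the
  absence of a further boundary term; the transform of the bounded second derivative stays bounded
  for \<open>Re w \<ge> 1\<close>.\<close>

lemma gstar_minus_asymp_right:
  assumes w: "Re w \<ge> 1"
  shows "norm (gstar (- w) - 1 - 1 / (2 * w)) \<le> 26 / norm w ^ 2"
proof -
  let ?v = logistic
  \<comment> \<open>\<open>k1\<close> and \<open>k2\<close> are the first and second derivatives of
    \<open>2 * v * (1 - v)\<close>, reduced by \<open>v' = v * (1 - v)\<close>. The bound 26 is the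
    crude \<open>2 * (1 + 6 + 6)\<close>.\<close>
  define k1 where "k1 = (\<lambda>s. 2 * (1 - 2 * ?v s) * (?v s * (1 - ?v s)))"
  define k2 where "k2 = (\<lambda>s. 2 * (1 - 6 * ?v s + 6 * ?v s ^ 2) * (?v s * (1 - ?v s)))"
  have v: "0 \<le> ?v s" "?v s \<le> 1" "0 \<le> ?v s * (1 - ?v s)" "?v s * (1 - ?v s) \<le> 1" for s
    using logistic_bounds[of s] by (auto intro!: mult_le_one)
  have b1: "\<bar>k1 s\<bar> \<le> 2" for s
  proof -
    have "\<bar>2 * (1 - 2 * ?v s)\<bar> * \<bar>?v s * (1 - ?v s)\<bar> \<le> 2 * 1" using v[of s] by (intro mult_mono) auto
    thus ?thesis by (simp add: k1_def abs_mult)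
  qed
  have b2: "\<bar>k2 s\<bar> \<le> 26" for s
  proof -
    have "?v s ^ 2 \<le> 1" using v[of s] by (simp add: power_le_one)
    moreover have "\<bar>2 * (1 - 6 * x + 6 * y)\<bar> \<le> 26" if "0 \<le> x" "x \<le> 1" "0 \<le> y" "y \<le> 1" for x y :: real
      using that by (simp add: abs_le_iff)
    ultimately have "\<bar>2 * (1 - 6 * ?v s + 6 * ?v s ^ 2)\<bar> \<le> 26"
      using v(1,2)[of s] by (meson zero_le_power2)
    hence "\<bar>2 * (1 - 6 * ?v s + 6 * ?v s ^ 2)\<bar> * \<bar>?v s * (1 - ?v s)\<bar> \<le> 26 * 1"
      using v[of s] by (intro mult_mono) auto
    thus ?thesis by (simp add: k2_def abs_mult)
  qed
  have w0: "Re w > 0" "w \<noteq> 0" using w by auto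
  have 1: "laplace (causal (\<lambda>s. of_real (k1 s))) w = w * laplace gconv_kernel w - 1 / 2"
  proof -
    have "laplace (causal (\<lambda>s. of_real (k1 s))) w = w * laplace gconv_kernel w - of_real (2 * ?v 0 * (1 - ?v 0))"
      unfolding gconv_kernel_def
    proof (rule laplace_derivative_real[where C = 2 and D = 2])
      show "((\<lambda>s. 2 * ?v s * (1 - ?v s)) has_real_derivative k1 s) (at s)" for s
        by (auto intro!: derivative_eq_intros DERIV_logistic simp: k1_def algebra_simps)
      show "isCont k1 s" for s unfolding k1_def by (intro continuous_intros)
      show "\<bar>2 * ?v s * (1 - ?v s)\<bar> \<le> 2" for s using v[of s] by (simp add: abs_mult mult.assoc)
    qed (use w0 b1 in auto)
    thus ?thesis by (simp add: logistic_def)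
  qed
  have 2: "laplace (causal (\<lambda>s. of_real (k2 s))) w = w * laplace (causal (\<lambda>s. of_real (k1 s))) w"
  proof -
    have "laplace (causal (\<lambda>s. of_real (k2 s))) w = w * laplace (causal (\<lambda>s. of_real (k1 s))) w - of_real (k1 0)"
    proof (rule laplace_derivative_real[where C = 2 and D = 26])
      show "(k1 has_real_derivative k2 s) (at s)" for s
        unfolding k1_def by (auto intro!: derivative_eq_intros DERIV_logistic simp: k2_def algebra_simps power2_eq_square)
      show "isCont k2 s" for s unfolding k2_def by (intro continuous_intros)
    qed (use w0 b1 b2 in auto)
    thus ?thesis by (simp add: k1_def logistic_def)
  qed
  have "gstar (- w) - 1 - 1 / (2 * w) = laplace (causal (\<lambda>s. of_real (k2 s))) w / w ^ 2"
  proof -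
    have "laplace gconv_kernel w = (1 / 2 + laplace (causal (\<lambda>s. of_real (k1 s))) w) / w"
      using 1 w0(2) by (simp add: field_simps)
    thus ?thesis using w0(2) unfolding 2 gstar_minus_eq_laplace[OF w0(1)]
      by (simp add: add_divide_distrib power2_eq_square)
  qed
  also have "norm \<dots> \<le> 26 / norm w ^ 2"
  proof -
    have "norm (laplace (causal (\<lambda>s. of_real (k2 s))) w) \<le> 26 / Re w"
    proof (rule norm_laplace_le)
      have "continuous_on {0..} (\<lambda>s. complex_of_real (k2 s))"
        unfolding k2_def by (intro continuous_at_imp_continuous_on ballI continuous_intros)
      hence "exp_order 0 (causal (\<lambda>s. of_real (k2 s)))"
        by (rule exp_order_causal[where C = 26]) (use b2 in auto)
      thus "causal (\<lambda>s. of_real (k2 s)) \<in> borel_measurable borel" by (rule exp_orderD)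
    qed (use b2 w0 in \<open>auto simp: causal_def\<close>)
    also have "\<dots> \<le> 26" using w by (simp add: divide_simps)
    finally show ?thesis by (simp add: norm_divide norm_power divide_right_mono)
  qed
  finally show ?thesis .
qed

section \<open>Continuation of the expansion to left half-planes\<close>

lemma gstar_minus_shift:
  assumes "w \<noteq> 0" "w \<noteq> -1"
  shows "gstar (- w) = 2 - w / (w + 1) * gstar (- (w + 1))"
proof -
  have "Digamma (w / 2 + 1) = Digamma (w / 2) + 1 / (w / 2)"
    using assms by (intro Digamma_plus1) auto
  moreover have "(1 + (w + 1)) / 2 = w / 2 + 1" by (simp add: field_simps)
  moreover have "w + 1 \<noteq> 0" using assms by (metis add_eq_0_iff2)
  ultimately show ?thesis using assms
    by (simp add: gstar_def field_simps add_eq_0_iff2)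
qed

text \<open>Each use of the shift gains one unit to the left, because the approximant
  \<open>1 + 1 / (2 * w)\<close> reproduces itself under it up to a term of third order. The radius
  \<open>R\<close> excludes the finitely many poles in the half-plane.\<close>

lemma gstar_minus_asymp:
  "\<exists>C R. C \<ge> 0 \<and> (\<forall>w. Re w \<ge> 1 - real m \<longrightarrow> norm w \<ge> R \<longrightarrow>
     norm (gstar (- w) - 1 - 1 / (2 * w)) \<le> C / norm w ^ 2)"
proof (induction m)
  case 0
  show ?case using gstar_minus_asymp_right by (intro exI[of _ 26] exI[of _ 0]) auto
next
  case (Suc m)
  then obtain C R where C: "C \<ge> 0" and IH: "\<And>w. Re w \<ge> 1 - real m \<Longrightarrow> norm w \<ge> R \<Longrightarrow>
     norm (gstar (- w) - 1 - 1 / (2 * w)) \<le> C / norm w ^ 2" by blast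
  \<comment> \<open>From \<open>norm (w + 1) \<ge> norm w / 2\<close> the old error grows by a
    factor 4 and \<open>w / (w + 1)\<close> contributes 2, hence \<open>8 * C\<close>. The
    third-order term is at most \<open>2 / norm w ^ 3\<close>, which \<open>norm w \<ge> 2\<close>
    turns into the summand 1. Radius \<open>R + 1\<close> keeps \<open>w + 1\<close> outside the old
    radius.\<close>
  have "norm (gstar (- w) - 1 - 1 / (2 * w)) \<le> (1 + 8 * C) / norm w ^ 2"
    if w: "Re w \<ge> 1 - real (Suc m)" "norm w \<ge> max 2 (R + 1)" for w
  proof -
    define e where "e = gstar (- (w + 1)) - 1 - 1 / (2 * (w + 1))"
    have n: "norm (w + 1) \<ge> norm w - 1" using norm_triangle_ineq2[of w "-1"] by simp
    have w0: "w \<noteq> 0" "w + 1 \<noteq> 0" "norm w > 0" using w n by auto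
    have n2: "norm (w + 1) \<ge> norm w / 2" using n w by linarith
    have "norm e \<le> C / norm (w + 1) ^ 2" unfolding e_def using w n by (intro IH) auto
    also have "\<dots> \<le> C / (norm w / 2) ^ 2"
      using C n2 w0 by (intro divide_left_mono power_mono mult_pos_pos) auto
    finally have e: "norm e \<le> 4 * C / norm w ^ 2" by (simp add: power_divide mult.commute)
    have "gstar (- w) - 1 - 1 / (2 * w) = - 1 / (2 * w * (w + 1) ^ 2) - w / (w + 1) * e"
    proof -
      have "gstar (- (w + 1)) = e + 1 + 1 / (2 * (w + 1))" by (simp add: e_def)
      moreover have "w \<noteq> -1" using w0 by auto
      ultimately have "gstar (- w) = 2 - w / (w + 1) * (e + 1 + 1 / (2 * (w + 1)))"
        using gstar_minus_shift[of w] w0 by simp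
      moreover have "1 - w / (w + 1) * (1 + 1 / (2 * (w + 1))) - 1 / (2 * w) = - 1 / (2 * w * (w + 1) ^ 2)"
      proof -
        define u where "u = w + 1"
        have "u \<noteq> 0" using w0 by (simp add: u_def)
        hence "1 - w / u * (1 + 1 / (2 * u)) - 1 / (2 * w) = (2 * w * (u * u) - w * (2 * w * u + w) - u * u) / (2 * w * u ^ 2)"
          using w0 by (simp add: divide_simps power2_eq_square) (simp add: algebra_simps)
        also have "2 * w * (u * u) - w * (2 * w * u + w) - u * u = - 1" unfolding u_def by (simp add: algebra_simps)
        finally show ?thesis unfolding u_def .
      qed
      moreover have "2 - x * (e + 1 + z) - 1 - y = (1 - x * (1 + z) - y) - x * e" for x y z :: complex
        by (simp add: algebra_simps)
      ultimately show ?thesis by presburger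
    qed
    also have "norm \<dots> \<le> norm (- 1 / (2 * w * (w + 1) ^ 2)) + norm (w / (w + 1) * e)"
      by (rule norm_triangle_ineq4)
    also have "norm (- 1 / (2 * w * (w + 1) ^ 2)) \<le> 1 / norm w ^ 2"
    proof -
      have "norm (- 1 / (2 * w * (w + 1) ^ 2)) = 1 / (2 * norm w * norm (w + 1) ^ 2)"
        by (simp add: norm_divide norm_mult norm_power)
      also have "\<dots> \<le> 1 / (2 * norm w * (norm w / 2) ^ 2)"
        using n2 w0 by (intro divide_left_mono mult_left_mono power_mono mult_pos_pos) auto
      also have "\<dots> = (2 / norm w) / norm w ^ 2" using w0 by (simp add: field_simps power2_eq_square)
      also have "\<dots> \<le> 1 / norm w ^ 2" using w w0 by (intro divide_right_mono) (auto simp: field_simps)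
      finally show ?thesis .
    qed
    also have "norm (w / (w + 1) * e) \<le> 2 * (4 * C / norm w ^ 2)"
      unfolding norm_mult norm_divide
      using n2 w0 e by (intro mult_mono) (auto simp: field_simps)
    finally show ?thesis by (simp add: add_divide_distrib)
  qed
  thus ?case using C by (intro exI[of _ "1 + 8 * C"] exI[of _ "max 2 (R + 1)"]) auto
qed

section \<open>The resolvent\<close>

text \<open>
  The function \<open>1 / gstar (- w)\<close> with its removable singularities at the poles of \<open>gstar\<close> filled in.
\<close>
definition gstar_recip :: "complex \<Rightarrow> complex" where
  "gstar_recip w = (if is_pole gstar (- w) then 0 else inverse (gstar (- w)))"

text \<open>Away from 0 the digamma expression is analytic; at 0 continuity of the patched function
  removes the singularity.\<close>

lemma holomorphic_gstar: "gstar holomorphic_on - (\<nat> - {0})"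
proof (rule no_isolated_singularity[where K = "{0}"])
  show "continuous_on (- (\<nat> - {0})) gstar"
    using isCont_gstar by (intro continuous_at_imp_continuous_on) auto
  show "open (- (\<nat> - {0}) :: complex set)"
    by (intro open_Compl closed_subset_Ints) (auto elim!: Nats_cases)
  have 1: "- z / 2 \<notin> \<int>\<^sub>\<le>\<^sub>0" if "z \<notin> \<nat>" for z :: complex
  proof
    assume "- z / 2 \<in> \<int>\<^sub>\<le>\<^sub>0"
    then obtain k where "- z / 2 = - of_nat k" by (auto elim: nonpos_Ints_cases')
    hence "z = of_nat (2 * k)" by (simp add: field_simps)
    with that show False by (metis of_nat_in_Nats)
  qed
  have 2: "(1 - z) / 2 \<notin> \<int>\<^sub>\<le>\<^sub>0" if "z \<notin> \<nat>" for z :: complex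
  proof
    assume "(1 - z) / 2 \<in> \<int>\<^sub>\<le>\<^sub>0"
    then obtain k where "(1 - z) / 2 = - of_nat k" by (auto elim: nonpos_Ints_cases')
    hence "z = of_nat (2 * k + 1)" by (simp add: field_simps)
    with that show False by (metis of_nat_in_Nats)
  qed
  have "(\<lambda>z. z * (Digamma (- z / 2) - Digamma ((1 - z) / 2))) analytic_on - \<nat>"
    by (intro analytic_intros) (use 1 2 in auto)
  hence "(\<lambda>z. z * (Digamma (- z / 2) - Digamma ((1 - z) / 2))) holomorphic_on - \<nat>"
    by (rule analytic_imp_holomorphic)
  moreover have "- (\<nat> - {0}) - {0} = (- \<nat> :: complex set)" by auto
  ultimately show "gstar holomorphic_on - (\<nat> - {0}) - {0}"
    by (auto elim!: holomorphic_transform simp: gstar_def)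
qed auto

text \<open>Off the poles this is the reciprocal of a zero-free function, and at a pole the
  extension by 0 is holomorphic. The poles are integers, so unit balls isolate them and the local
  statements glue. The zero-free hypothesis leaves out the poles, where the value of
  \<open>gstar\<close> is an artefact of totalisation.\<close>

lemma holomorphic_gstar_recip:
  assumes nz: "\<And>z. Re z < \<alpha> \<Longrightarrow> \<not> is_pole gstar z \<Longrightarrow> gstar z \<noteq> 0"
  shows "gstar_recip holomorphic_on {w. Re w > - \<alpha>}"
proof -
  define S where "S = {w. Re w > - \<alpha>}"
  define P where "P = {w. - w \<in> \<nat> - {0::complex}}"
  have "open S" unfolding S_def by (rule open_halfspace_Re_gt)
  have "P \<subseteq> \<int>"
  proof
    fix w assume "w \<in> P"
    then obtain n where "- w = of_nat n" by (auto simp: P_def elim: Nats_cases)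
    hence "w = - of_int (int n)" by (metis minus_minus of_int_of_nat_eq)
    thus "w \<in> \<int>" by simp
  qed
  hence "open (S - P)" using \<open>open S\<close> by (intro open_Diff closed_subset_Ints)
  have g: "(\<lambda>w. gstar (- w)) holomorphic_on - P"
  proof -
    have "gstar \<circ> uminus holomorphic_on - P"
      by (rule holomorphic_on_compose_gen[OF _ holomorphic_gstar]) (auto simp: P_def intro!: holomorphic_intros)
    thus ?thesis by (simp add: o_def)
  qed
  have pole: "is_pole gstar (- w) \<longleftrightarrow> w \<in> P" for w by (simp add: is_pole_gstar_iff P_def)
  have ne: "gstar (- w) \<noteq> 0" if "w \<in> S" "w \<notin> P" for w
    using nz[of "- w"] that pole[of w] by (auto simp: S_def)
  have "(\<lambda>w. inverse (gstar (- w))) holomorphic_on S - P"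
    by (intro holomorphic_on_inverse holomorphic_on_subset[OF g]) (use ne in auto)
  hence 1: "gstar_recip holomorphic_on S - P"
    by (rule holomorphic_transform) (auto simp: gstar_recip_def pole)
  have 2: "gstar_recip holomorphic_on S \<inter> ball p 1" if p: "p \<in> P" for p
  proof -
    have sep: "w \<notin> P" if "w \<in> ball p 1 - {p}" for w
    proof
      assume "w \<in> P"
      hence "w \<in> \<int>" "p \<in> \<int>" using \<open>P \<subseteq> \<int>\<close> p by auto
      then obtain i j where "w = of_int i" "p = of_int j" by (auto elim!: Ints_cases)
      moreover have "dist (of_int j) (of_int i :: complex) = \<bar>real_of_int (j - i)\<bar>"
        unfolding dist_norm by (metis norm_of_int of_int_diff)
      ultimately show False using that by auto
    qed
    have "(\<lambda>w. if w = p then 0 else inverse (gstar (- w))) holomorphic_on S \<inter> ball p 1"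
    proof (rule is_pole_inverse_holomorphic)
      show "open (S \<inter> ball p 1)" using \<open>open S\<close> by auto
      show "(\<lambda>w. gstar (- w)) holomorphic_on S \<inter> ball p 1 - {p}"
        by (rule holomorphic_on_subset[OF g]) (use sep in auto)
      have "filterlim gstar at_infinity (at (- p))" using pole[of p] p by (simp add: is_pole_def)
      moreover have "filterlim uminus (at (- p)) (at p)"
        by (intro filterlim_atI tendsto_intros) (auto simp: eventually_at_filter)
      ultimately show "is_pole (\<lambda>w. gstar (- w)) p"
        unfolding is_pole_def by (rule filterlim_compose)
      show "\<forall>w\<in>S \<inter> ball p 1 - {p}. gstar (- w) \<noteq> 0" using sep ne by auto
    qed
    thus ?thesis by (rule holomorphic_transform) (use sep p in \<open>auto simp: gstar_recip_def pole\<close>)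
  qed
  have "gstar_recip holomorphic_on (S - P) \<union> (\<Union>p\<in>P. S \<inter> ball p 1)"
    by (intro holomorphic_on_Un holomorphic_on_UN_open 1 2 open_UN \<open>open (S - P)\<close>) (use \<open>open S\<close> in auto)
  moreover have "(S - P) \<union> (\<Union>p\<in>P. S \<inter> ball p 1) = S"
  proof -
    have "w \<in> ball w 1" for w :: complex by simp
    thus ?thesis by blast
  qed
  ultimately show ?thesis by (simp add: S_def)
qed

text \<open>With \<open>d = 1 / (2 * w)\<close> and \<open>G = 1 + d + e\<close> one has
  \<open>G * (1 / G - 1 + d) = d^2 - e + e * d\<close>, while \<open>norm d\<close> and
  \<open>norm e\<close> are at most \<open>1 / 4\<close>, so that
  \<open>norm G \<ge> 1 / 2\<close>.\<close>

lemma inverse_second_order_bound: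
  fixes G w :: complex
  assumes "norm (G - 1 - 1 / (2 * w)) \<le> C / norm w ^ 2" "norm w \<ge> 2" "norm w \<ge> 4 * C" "C \<ge> 0"
  shows "norm (inverse G - 1 + 1 / (2 * w)) \<le> (1 + 4 * C) / norm w ^ 2"
proof -
  define e where "e = G - 1 - 1 / (2 * w)"
  define n where "n = norm w"
  have n: "n \<ge> 2" "n > 0" "n \<ge> 4 * C" using assms by (auto simp: n_def)
  have w0: "w \<noteq> 0" using assms by auto
  have e: "norm e \<le> C / n ^ 2" using assms by (simp add: e_def n_def)
  have "C / n ^ 2 \<le> 1 / 4"
  proof -
    have "4 * C * 1 \<le> n * n" using n assms(4) by (intro mult_mono) auto
    thus ?thesis using n by (simp add: field_simps power2_eq_square)
  qed
  hence e4: "norm e \<le> 1 / 4" using e by linarith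
  have w4: "norm (1 / (2 * w)) \<le> 1 / 4" using n by (simp add: norm_divide norm_mult field_simps flip: n_def)
  have "norm (1::complex) \<le> norm (1 / (2 * w) + e) + norm G"
    using norm_triangle_ineq4[of G "1 / (2 * w) + e"] by (simp add: e_def)
  hence G: "norm G \<ge> 1 / 2" using norm_triangle_ineq[of "1 / (2 * w)" e] e4 w4 by simp
  hence G0: "G \<noteq> 0" by auto
  have Ge: "G = 1 + 1 / (2 * w) + e" by (simp add: e_def)
  have "G * (inverse G - 1 + 1 / (2 * w)) = 1 - G + G * (1 / (2 * w))"
    using G0 by (simp add: algebra_simps)
  also have "\<dots> = 1 / (2 * w) * (1 / (2 * w)) - e + e * (1 / (2 * w))"
    unfolding Ge by (simp only: algebra_simps) simp
  finally have "norm G * norm (inverse G - 1 + 1 / (2 * w)) = norm (1 / (2 * w) * (1 / (2 * w)) - e + e * (1 / (2 * w)))"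
    by (metis norm_mult)
  also have "\<dots> \<le> norm (1 / (2 * w) * (1 / (2 * w))) + norm e + norm (e * (1 / (2 * w)))"
    using norm_triangle_ineq[of "1 / (2 * w) * (1 / (2 * w)) - e" "e * (1 / (2 * w))"]
      norm_triangle_ineq4[of "1 / (2 * w) * (1 / (2 * w))" e] by linarith
  also have "norm (e * (1 / (2 * w))) \<le> norm e * 1" unfolding norm_mult using w4 by (intro mult_left_mono) auto
  also have "norm (1 / (2 * w) * (1 / (2 * w))) = (1 / 4) / n ^ 2"
    by (simp add: norm_mult norm_divide n_def power2_eq_square)
  finally have "norm G * norm (inverse G - 1 + 1 / (2 * w)) \<le> (1 / 4 + 2 * C) / n ^ 2"
    using e by (simp add: add_divide_distrib)
  moreover have "1 / 2 * norm (inverse G - 1 + 1 / (2 * w)) \<le> norm G * norm (inverse G - 1 + 1 / (2 * w))"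
    using G by (intro mult_right_mono) auto
  ultimately have "norm (inverse G - 1 + 1 / (2 * w)) \<le> 2 * ((1 / 4 + 2 * C) / n ^ 2)" by linarith
  also have "\<dots> \<le> (1 + 4 * C) / n ^ 2" using n by (simp add: field_simps)
  finally show ?thesis by (simp add: n_def)
qed

text \<open>\<open>1 / (2 * w)\<close> has a pole at 0, which may lie inside the half-plane. Moving
  that pole to \<open>- M\<close>, left of the half-plane, changes the function only by
  \<open>O(1 / w^2)\<close>.\<close>

lemma gstar_recip_decay:
  assumes nz: "\<And>z. Re z < \<alpha> \<Longrightarrow> \<not> is_pole gstar z \<Longrightarrow> gstar z \<noteq> 0" and \<sigma>: "\<sigma> < \<alpha>" "\<sigma> < M" and M: "M > 0"
  obtains C where "\<And>w. Re w \<ge> - \<sigma> \<Longrightarrow>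
    norm (gstar_recip w - 1 + 1 / (2 * (w + of_real M))) \<le> C / (1 + norm w ^ 2)"
proof -
  define F where "F = (\<lambda>w. gstar_recip w - 1 + 1 / (2 * (w + of_real M)))"
  define m where "m = nat \<lceil>\<sigma> + 1\<rceil>"
  have m: "1 - real m \<le> - \<sigma>" unfolding m_def by linarith
  obtain C R where C: "C \<ge> 0" and as: "\<And>w. Re w \<ge> 1 - real m \<Longrightarrow> norm w \<ge> R \<Longrightarrow>
     norm (gstar (- w) - 1 - 1 / (2 * w)) \<le> C / norm w ^ 2"
    using gstar_minus_asymp[of m] by blast
  \<comment> \<open>Each threshold required below is a summand; \<open>\<bar>R\<bar>\<close>
    compensates for a possibly negative \<open>R\<close>.\<close>
  define R' where "R' = R + 2 + 4 * C + 2 * M + real m + \<bar>R\<bar>"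
  define K1 where "K1 = 2 * (1 + 4 * C + M)"
  have far: "norm (F w) \<le> K1 / (1 + norm w ^ 2)" if w: "Re w \<ge> - \<sigma>" "norm w \<ge> R'" for w
  proof -
    have n: "norm w \<ge> R" "norm w \<ge> 2" "norm w \<ge> 4 * C" "norm w \<ge> 2 * M" "norm w > real m"
      using w(2) C M by (auto simp: R'_def)
    \<comment> \<open>A pole \<open>w = - k\<close> in the half-plane satisfies
      \<open>k \<le> \<sigma> < m\<close>, hence lies within the radius.\<close>
    have np: "\<not> is_pole gstar (- w)"
    proof
      assume "is_pole gstar (- w)"
      then obtain k where k: "- w = of_nat k" by (auto simp: is_pole_gstar_iff elim: Nats_cases)
      hence w_eq: "w = - of_nat k" by (metis minus_minus)
      hence "norm w = real k" by simp
      moreover have "real k \<le> \<sigma>" using w(1) w_eq by simp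
      ultimately show False using n(5) m by linarith
    qed
    have 1: "norm (gstar_recip w - 1 + 1 / (2 * w)) \<le> (1 + 4 * C) / norm w ^ 2"
      unfolding gstar_recip_def using np as[of w] n m w C by (simp add: inverse_second_order_bound)
    have nM: "norm (w + of_real M) \<ge> norm w / 2"
    proof -
      have "norm (w + of_real M) \<ge> norm w - M" using norm_triangle_ineq2[of w "- of_real M"] M by simp
      thus ?thesis using n by linarith
    qed
    have 2: "norm (1 / (2 * (w + of_real M)) - 1 / (2 * w)) \<le> M / norm w ^ 2"
    proof -
      have "w \<noteq> 0" "w + of_real M \<noteq> 0" using n nM by auto
      moreover have "1 / (2 * u) - 1 / (2 * w) = - (u - w) / (2 * w * u)" if "u \<noteq> 0" "w \<noteq> 0" for u
        using that by (simp add: field_simps)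
      ultimately have "1 / (2 * (w + of_real M)) - 1 / (2 * w) = - of_real M / (2 * w * (w + of_real M))"
        by (metis add_diff_cancel_left')
      hence "norm (1 / (2 * (w + of_real M)) - 1 / (2 * w)) = M / (2 * norm w * norm (w + of_real M))"
        using M by (simp add: norm_divide norm_mult)
      also have "\<dots> \<le> M / (2 * norm w * (norm w / 2))"
        using M n nM by (intro divide_left_mono mult_left_mono mult_pos_pos) auto
      finally show ?thesis by (simp add: power2_eq_square)
    qed
    have "norm (F w) \<le> norm (gstar_recip w - 1 + 1 / (2 * w)) + norm (1 / (2 * (w + of_real M)) - 1 / (2 * w))"
    proof -
      have "F w = (gstar_recip w - 1 + 1 / (2 * w)) + (1 / (2 * (w + of_real M)) - 1 / (2 * w))"
        unfolding F_def by (simp only: algebra_simps)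
      thus ?thesis by (metis norm_triangle_ineq)
    qed
    also have "\<dots> \<le> (1 + 4 * C + M) / norm w ^ 2" using 1 2 by (simp add: add_divide_distrib)
    also have "\<dots> = K1 / (2 * norm w ^ 2)"
      unfolding K1_def by (rule mult_divide_mult_cancel_left[symmetric]) simp
    also have "\<dots> \<le> K1 / (1 + norm w ^ 2)"
    proof (rule divide_left_mono)
      have "1 \<le> norm w ^ 2" using n by (intro one_le_power) auto
      thus "1 + norm w ^ 2 \<le> 2 * norm w ^ 2" by linarith
    qed (use C M n in \<open>auto simp: K1_def intro!: mult_pos_pos add_pos_nonneg\<close>)
    finally show ?thesis .
  qed
  \<comment> \<open>Within radius \<open>R'\<close> compactness replaces the expansion; there
    \<open>1 + norm w ^ 2\<close> is at most \<open>1 + R' ^ 2\<close>, so a constant bound has the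
    required form.\<close>
  have "bounded (F ` ({w. Re w \<ge> - \<sigma>} \<inter> cball 0 R'))"
  proof (intro compact_imp_bounded compact_continuous_image)
    have "gstar_recip holomorphic_on {w. Re w > - \<alpha>}" using nz by (rule holomorphic_gstar_recip)
    hence "continuous_on {w. Re w > - \<alpha>} gstar_recip" by (rule holomorphic_on_imp_continuous_on)
    hence "continuous_on ({w. Re w \<ge> - \<sigma>} \<inter> cball 0 R') gstar_recip"
      by (rule continuous_on_subset) (use \<sigma> in auto)
    moreover have "2 * (w + of_real M) \<noteq> 0" if "Re w \<ge> - \<sigma>" for w
      using that \<sigma> by (auto simp: complex_eq_iff)
    ultimately show "continuous_on ({w. Re w \<ge> - \<sigma>} \<inter> cball 0 R') F"
      unfolding F_def by (intro continuous_intros) auto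
    show "compact ({w. Re w \<ge> - \<sigma>} \<inter> cball 0 R')"
      by (intro closed_Int_compact closed_halfspace_Re_ge compact_cball)
  qed
  then obtain B where "\<And>w. w \<in> {w. Re w \<ge> - \<sigma>} \<inter> cball 0 R' \<Longrightarrow> norm (F w) \<le> B"
    unfolding bounded_iff by blast
  hence B: "\<And>w. Re w \<ge> - \<sigma> \<Longrightarrow> norm w \<le> R' \<Longrightarrow> norm (F w) \<le> B"
    by simp
  have near: "norm (F w) \<le> \<bar>B\<bar> * (1 + R' ^ 2) / (1 + norm w ^ 2)" if w: "Re w \<ge> - \<sigma>" "norm w \<le> R'" for w
  proof -
    have "norm w ^ 2 \<le> R' ^ 2" using w by (intro power_mono) auto
    hence "norm (F w) * (1 + norm w ^ 2) \<le> \<bar>B\<bar> * (1 + R' ^ 2)"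
      using B[OF w] by (intro mult_mono) auto
    thus ?thesis by (simp add: le_divide_eq add_pos_nonneg)
  qed
  show ?thesis
  proof (rule that)
    fix w assume w: "Re w \<ge> - \<sigma>"
    have "norm (F w) \<le> max K1 (\<bar>B\<bar> * (1 + R' ^ 2)) / (1 + norm w ^ 2)"
    proof (cases "norm w \<le> R'")
      case True
      show ?thesis by (rule order_trans[OF near[OF w True]]) (intro divide_right_mono, auto)
    next
      case False
      show ?thesis by (rule order_trans[OF far[OF w]]) (use False in \<open>auto intro!: divide_right_mono\<close>)
    qed
    thus "norm (gstar_recip w - 1 + 1 / (2 * (w + of_real M))) \<le> max K1 (\<bar>B\<bar> * (1 + R' ^ 2)) / (1 + norm w ^ 2)"
      by (simp add: F_def)
  qed
qed

text \<open>The subtracted term is restored after inversion: \<open>1 / (w + M)\<close> is the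
  transform of \<open>exp (- M * s)\<close>, which decays faster than
  \<open>exp (- \<sigma> * s)\<close> since \<open>\<sigma> < M\<close>.\<close>

lemma resolvent_exists:
  assumes nz: "\<And>z. Re z < \<alpha> \<Longrightarrow> \<not> is_pole gstar z \<Longrightarrow> gstar z \<noteq> 0" and \<sigma>: "\<sigma> < \<alpha>"
  obtains r where "continuous_on {0..} r" "exp_order (- \<sigma>) r"
    "\<And>w. Re w > - \<sigma> \<Longrightarrow> laplace r w = gstar_recip w - 1"
proof -
  \<comment> \<open>\<open>M\<close> exceeds \<alpha> as well, so \<open>- M\<close> lies outside
    the whole half-plane on which the reciprocal is known to be holomorphic.\<close>
  define M where "M = \<bar>\<sigma>\<bar> + \<bar>\<alpha>\<bar> + 1"
  have M: "\<sigma> < M" "\<alpha> < M" "M > 0" by (auto simp: M_def)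
  define F where "F = (\<lambda>w. gstar_recip w - 1 + 1 / (2 * (w + of_real M)))"
  obtain C where C: "\<And>w. Re w \<ge> - \<sigma> \<Longrightarrow> norm (F w) \<le> C / (1 + norm w ^ 2)"
    unfolding F_def using gstar_recip_decay[OF nz \<sigma> M(1,3)] by blast
  have Mne: "2 * (w + of_real M) \<noteq> 0" if "Re w > - \<alpha>" for w
    using that M by (auto simp: complex_eq_iff)
  have "F holomorphic_on {w. Re w > - \<alpha>}"
    unfolding F_def by (intro holomorphic_intros holomorphic_gstar_recip nz) (use Mne in blast)+
  then obtain h where h: "continuous_on UNIV h" "exp_order (- \<sigma>) (causal h)"
    "\<And>w. Re w > - \<sigma> \<Longrightarrow> laplace (causal h) w = F w"
    by (rule laplace_surj_half_plane[where a = "- \<sigma>"]) (use \<sigma> C in auto)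
  let ?e = "causal (\<lambda>s. exp (- of_real M * of_real s))"
  have e: "exp_order (- \<sigma>) ?e"
    using exp_order_mono[OF laplace_exp(1)[of "- of_real M" 0], of "- \<sigma>"] M by simp
  have eL: "laplace ?e w = 1 / (w + of_real M)" if "Re w > - \<sigma>" for w
    using laplace_exp(2)[of "- of_real M" w] that M by simp
  define r where "r = (\<lambda>s. causal h s + (- 1 / 2) * ?e s)"
  show ?thesis
  proof (rule that[of r])
    have "continuous_on {0..} (\<lambda>s. h s + (- 1 / 2) * exp (- of_real M * of_real s))"
      by (intro continuous_intros continuous_on_subset[OF h(1)]) auto
    thus "continuous_on {0..} r"
      by (rule continuous_on_eq) (auto simp: r_def causal_def)
    show "exp_order (- \<sigma>) r" unfolding r_def by (intro exp_order_add exp_order_cmult h e)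
    fix w assume w: "Re w > - \<sigma>"
    have "laplace r w = laplace (causal h) w + laplace (\<lambda>s. (- 1 / 2) * ?e s) w"
      unfolding r_def by (rule laplace_add[OF h(2) exp_order_cmult[OF e] w])
    also have "\<dots> = F w - 1 / (2 * (w + of_real M))"
    proof -
      have "- 1 / 2 * (1 / u) = - (1 / (2 * u))" for u :: complex by simp
      thus ?thesis unfolding laplace_cmult h(3)[OF w] eL[OF w] by (metis add_uminus_conv_diff)
    qed
    finally show "laplace r w = gstar_recip w - 1" by (simp add: F_def)
  qed
qed

section \<open>Convolution form of the weighted sum\<close>

text \<open>The effect of a single jump of \<open>A\<close> at \<open>n = exp c\<close>: a unit step
  convolved with the kernel gives \<open>g(n / x) - 1\<close>, with 1 coming from
  \<open>g(1)\<close>.\<close>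

lemma gconv_kernel_has_integral:
  assumes "c \<le> s"
  shows "has_bochner_integral lborel (\<lambda>t. gconv_kernel (s - t) * indicator {c..} t)
           (of_real (2 * logistic (s - c) - 1))"
proof -
  let ?f = "\<lambda>t. complex_of_real (2 * logistic (s - t) * (1 - logistic (s - t)))"
  have "has_bochner_integral lborel (\<lambda>t. indicator {c..s} t *\<^sub>R ?f t)
     (of_real (- 2 * logistic (s - s)) - of_real (- 2 * logistic (s - c)))"
  proof (rule has_bochner_integral_FTC_Icc[OF assms])
    fix t
    have "((\<lambda>t. logistic (s - t)) has_real_derivative logistic (s - t) * (1 - logistic (s - t)) * (0 - 1)) (at t)"
      by (rule DERIV_chain2[OF DERIV_logistic DERIV_diff[OF DERIV_const DERIV_ident]])
    from DERIV_cmult[OF this, of "-2"]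
    have "((\<lambda>t. - 2 * logistic (s - t)) has_real_derivative 2 * logistic (s - t) * (1 - logistic (s - t))) (at t within {c..s})"
      by (rule has_field_derivative_at_within[OF DERIV_cong]) simp
    thus "((\<lambda>t. complex_of_real (- 2 * logistic (s - t))) has_vector_derivative ?f t) (at t within {c..s})"
      by (rule has_vector_derivative_of_real)
  next
    have "continuous_on UNIV logistic" by (intro continuous_at_imp_continuous_on ballI isCont_logistic)
    hence "continuous_on {c..s} (\<lambda>t. logistic (s - t))"
      by (rule continuous_on_compose2) (auto intro!: continuous_intros)
    thus "continuous_on {c..s} ?f" by (intro continuous_intros)
  qed
  moreover have "indicator {c..s} t *\<^sub>R ?f t = gconv_kernel (s - t) * indicator {c..} t" for t
    by (cases "t < c"; cases "t > s") (simp_all add: gconv_kernel_def causal_def indicator_def)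
  moreover have "of_real (- 2 * logistic (s - s)) - of_real (- 2 * logistic (s - c)) = complex_of_real (2 * logistic (s - c) - 1)"
    by (simp add: logistic_def)
  ultimately show ?thesis by (simp only:)
qed

lemma le_nat_floor_exp_iff:
  assumes "n \<ge> 1"
  shows "n \<le> nat \<lfloor>exp t\<rfloor> \<longleftrightarrow> ln (real n) \<le> t"
proof -
  have "n \<le> nat \<lfloor>exp t\<rfloor> \<longleftrightarrow> real n \<le> exp t" by (simp add: le_nat_iff le_floor_iff)
  also have "\<dots> \<longleftrightarrow> ln (real n) \<le> t" using assms ln_ge_iff[of "real n" t] exp_le_cancel_iff[of "ln (real n)" t] by simp
  finally show ?thesis .
qed

lemma nat_floor_exp_neg: "(s::real) < 0 \<Longrightarrow> nat \<lfloor>exp s\<rfloor> = 0"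
  using le_nat_floor_exp_iff[of 1 s] by auto

text \<open>Partial summation carried out for one summand at a time: the split
  \<open>g(n / x) = 1 + (g(n / x) - 1)\<close> separates the step at \<open>ln n\<close> from its
  convolution with the kernel.\<close>

lemma weighted_summatory_eq_conv:
  "weighted_summatory gker a (exp s) =
     summatory a (exp s) + conv gconv_kernel (\<lambda>s. summatory a (exp s)) s"
proof -
  define N where "N = nat \<lfloor>exp s\<rfloor>"
  have hb: "has_bochner_integral lborel (\<lambda>t. \<Sum>n=1..N. a n * (gconv_kernel (s - t) * indicator {ln (real n)..} t))
      (\<Sum>n=1..N. a n * of_real (2 * logistic (s - ln (real n)) - 1))"
  proof (intro has_bochner_integral_sum has_bochner_integral_mult_right gconv_kernel_has_integral)
    fix n assume "n \<in> {1..N}"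
    thus "ln (real n) \<le> s" using le_nat_floor_exp_iff[of n s] by (simp add: N_def)
  qed
  \<comment> \<open>The kernel vanishes for \<open>t > s\<close>, so indices up to \<open>N\<close>
    describe the integrand for every \<open>t\<close>.\<close>
  have "gconv_kernel (s - t) * summatory a (exp t) =
      (\<Sum>n=1..N. a n * (gconv_kernel (s - t) * indicator {ln (real n)..} t))" for t
  proof (cases "t \<le> s")
    case True
    have "summatory a (exp t) = (\<Sum>n=1..N. a n * indicator {ln (real n)..} t)"
    proof -
      have "{1..nat \<lfloor>exp t\<rfloor>} = {n\<in>{1..N}. ln (real n) \<le> t}"
        using True le_nat_floor_exp_iff[of _ t] le_nat_floor_exp_iff[of _ s] by (force simp: N_def)
      hence "summatory a (exp t) = (\<Sum>n\<in>{n\<in>{1..N}. ln (real n) \<le> t}. a n)" by (simp add: summatory_def)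
      also have "\<dots> = (\<Sum>n=1..N. if ln (real n) \<le> t then a n else 0)" by (rule sum.inter_filter) simp
      also have "\<dots> = (\<Sum>n=1..N. a n * indicator {ln (real n)..} t)"
        by (intro sum.cong) (auto simp: indicator_def)
      finally show ?thesis .
    qed
    thus ?thesis unfolding sum_distrib_left by (simp only: sum_distrib_left mult.left_commute)
  qed (simp add: gconv_kernel_def causal_def)
  hence "conv gconv_kernel (\<lambda>s. summatory a (exp s)) s = (\<Sum>n=1..N. a n * of_real (2 * logistic (s - ln (real n)) - 1))"
    unfolding conv_def using has_bochner_integral_integral_eq[OF hb] by presburger
  also have "\<dots> = (\<Sum>n=1..N. a n * of_real (gker (real n / exp s)) - a n)"
  proof (intro sum.cong refl)
    fix n assume "n \<in> {1..N}"
    hence "exp (- (s - ln (real n))) = real n / exp s" by (simp add: exp_diff exp_minus field_simps)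
    hence "2 * logistic (s - ln (real n)) = gker (real n / exp s)" unfolding logistic_def gker_def by simp
    thus "a n * of_real (2 * logistic (s - ln (real n)) - 1) = a n * of_real (gker (real n / exp s)) - a n"
      by (simp only:) (simp add: algebra_simps)
  qed
  finally show ?thesis by (simp add: weighted_summatory_def summatory_def sum_subtractf N_def)
qed

section \<open>Measurability and growth of the summatory functions\<close>

lemma measurable_nat_floor_exp [measurable]: "(\<lambda>s. nat \<lfloor>exp s :: real\<rfloor>) \<in> borel \<rightarrow>\<^sub>M count_space UNIV"
  by measurable

lemma measurable_weighted_summatory:
  "(\<lambda>s. weighted_summatory gker a (exp s)) \<in> borel_measurable borel"
  unfolding weighted_summatory_def gker_def
  by (rule measurable_compose_countable[OF _ measurable_nat_floor_exp]) measurable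

lemma measurable_summatory: "(\<lambda>s. summatory a (exp s)) \<in> borel_measurable borel"
  unfolding summatory_def
  by (rule measurable_compose_countable[OF _ measurable_nat_floor_exp]) measurable

text \<open>
  The kernel has mass \<open>(n - 1) / (n + 1) < 1\<close> on \<open>[0, ln n]\<close>, so evaluating the convolution equation where
  \<open>norm A\<close> is maximal bounds that maximum.
\<close>
lemma summatory_growth:
  assumes M: "\<And>s. norm (weighted_summatory gker a (exp s)) \<le> M" and s: "s \<ge> 0"
  shows "norm (summatory a (exp s)) \<le> M * exp s"
proof -
  define N where "N = nat \<lfloor>exp s\<rfloor>"
  have N1: "1 \<le> N" using s le_nat_floor_exp_iff[of 1 s] by (simp add: N_def)
  define T where "T = (\<lambda>n. norm (\<Sum>i=1..n. a i))"
  \<comment> \<open>\<open>A\<close> is a step function, so its largest modulus on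
    \<open>[1, exp s]\<close> is attained at an integer.\<close>
  define S where "S = Max (T ` {1..N})"
  have "S \<in> T ` {1..N}" unfolding S_def using N1 by (intro Max_in) auto
  then obtain n where n: "n \<in> {1..N}" "S = T n" by blast
  have S0: "S \<ge> 0" unfolding n(2) T_def by simp
  define u where "u = ln (real n)"
  have un: "exp u = real n" "u \<ge> 0" using n by (auto simp: u_def)
  have us: "u \<le> s" using le_nat_floor_exp_iff[of n s] n by (simp add: u_def N_def)
  have Bu: "norm (summatory a (exp u)) = S" unfolding summatory_def un n(2) T_def by simp
  have B_le: "norm (summatory a (exp t)) \<le> S * indicator {0..} t" if "t \<le> u" for t
  proof (cases "t < 0")
    case True
    thus ?thesis by (simp add: summatory_def nat_floor_exp_neg)
  next
    case False
    have "nat \<lfloor>exp t\<rfloor> \<in> {1..N}"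
      unfolding N_def using False that us le_nat_floor_exp_iff[of 1 t] by (auto intro!: nat_mono floor_mono)
    hence "T (nat \<lfloor>exp t\<rfloor>) \<le> S" unfolding S_def by (intro Max_ge) auto
    thus ?thesis using False by (simp add: T_def summatory_def)
  qed
  have kn: "norm (gconv_kernel v) = Re (gconv_kernel v)" for v
  proof (cases "v < 0")
    case False
    have "2 * logistic v * (1 - logistic v) \<ge> 0" using logistic_bounds[of v] by simp
    thus ?thesis using False unfolding gconv_kernel_def causal_def by (simp only: norm_of_real Re_complex_of_real if_False abs_of_nonneg)
  qed (simp add: gconv_kernel_def causal_def)
  have hb: "has_bochner_integral lborel (\<lambda>t. S * Re (gconv_kernel (u - t) * indicator {0..} t)) (S * (2 * logistic u - 1))"
    using has_bochner_integral_bounded_linear[OF bounded_linear_Re gconv_kernel_has_integral[OF un(2)]]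
    by (intro has_bochner_integral_mult_right) simp
  have dom: "norm (gconv_kernel (u - t) * summatory a (exp t)) \<le> S * Re (gconv_kernel (u - t) * indicator {0..} t)" for t
  proof (cases "t \<le> u")
    case True
    have "norm (gconv_kernel (u - t) * summatory a (exp t)) \<le> Re (gconv_kernel (u - t)) * (S * indicator {0..} t)"
      unfolding norm_mult kn[symmetric] by (intro mult_left_mono B_le True) auto
    thus ?thesis by (auto simp: indicator_def mult_ac)
  qed (simp add: gconv_kernel_def causal_def)
  note [measurable] = exp_orderD(1)[OF exp_order_gconv_kernel] measurable_summatory
  have dom_int: "integrable lborel (\<lambda>t. S * Re (gconv_kernel (u - t) * indicator {0..} t))"
    using hb by (simp only: has_bochner_integral_iff)
  have "norm (conv gconv_kernel (\<lambda>s. summatory a (exp s)) u) \<le> (\<integral>t. S * Re (gconv_kernel (u - t) * indicator {0..} t) \<partial>lborel)"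
    unfolding conv_def
  proof (rule Bochner_Integration.integral_norm_bound_integral)
    show "integrable lborel (\<lambda>t. gconv_kernel (u - t) * summatory a (exp t))"
    proof (rule Bochner_Integration.integrable_bound[OF dom_int])
      show "AE t in lborel. norm (gconv_kernel (u - t) * summatory a (exp t)) \<le> norm (S * Re (gconv_kernel (u - t) * indicator {0..} t))"
        unfolding real_norm_def by (intro AE_I2 order_trans[OF dom abs_ge_self])
    qed measurable
  qed (use dom dom_int in auto)
  also have "\<dots> = S * (2 * logistic u - 1)" using hb by (simp add: has_bochner_integral_iff)
  finally have conv_le: "norm (conv gconv_kernel (\<lambda>s. summatory a (exp s)) u) \<le> S * (2 * logistic u - 1)" .
  \<comment> \<open>The factor of \<open>S\<close> on the right is below 1; solving for
    \<open>S\<close> gives \<open>M * (n + 1) / 2\<close>, which \<open>n \<ge> 1\<close> bounds by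
    \<open>M * n\<close>.\<close>
  have "S \<le> M + S * (2 * logistic u - 1)"
    using weighted_summatory_eq_conv[of a u] M[of u] conv_le Bu
      norm_triangle_ineq4[of "weighted_summatory gker a (exp u)" "conv gconv_kernel (\<lambda>s. summatory a (exp s)) u"]
    by (simp add: algebra_simps)
  moreover have "logistic u = real n / (real n + 1)"
    using n by (simp add: logistic_def exp_minus un(1) divide_simps)
  ultimately have "S \<le> M * (real n + 1) / 2"
    by (simp add: field_simps)
  also have "\<dots> \<le> M * exp u"
  proof -
    have "M \<ge> 0" using M[of 0] norm_ge_zero order_trans by blast
    hence "M * (real n + 1) \<le> M * (2 * real n)" using n by (intro mult_left_mono) auto
    thus ?thesis by (simp add: un(1))
  qed
  also have "\<dots> \<le> M * exp s" using us M[of 0] by (intro mult_left_mono) (auto intro: order_trans[OF norm_ge_zero])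
  finally have "S \<le> M * exp s" .
  moreover have "norm (summatory a (exp s)) \<le> S"
  proof -
    have "T N \<le> S" unfolding S_def using N1 by (intro Max_ge) auto
    thus ?thesis by (simp add: T_def summatory_def N_def)
  qed
  ultimately show ?thesis by linarith
qed

section \<open>Inverting the convolution\<close>

text \<open>
  Both \<open>k * B\<close> and \<open>- r * f\<close> are continuous, unlike \<open>B\<close>, so uniqueness of Laplace transforms
  yields the identity at every point.
\<close>
lemma summatory_eq_resolvent:
  assumes nz: "\<And>z. Re z < \<alpha> \<Longrightarrow> \<not> is_pole gstar z \<Longrightarrow> gstar z \<noteq> 0" and \<alpha>: "\<alpha> > 0"
    and r: "continuous_on {0..} r" "exp_order b r" "b \<le> 0" "\<And>w. Re w > b \<Longrightarrow> laplace r w = gstar_recip w - 1"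
    and f: "exp_order 0 (\<lambda>s. weighted_summatory gker a (exp s))"
  shows "summatory a (exp s) = weighted_summatory gker a (exp s) + conv r (\<lambda>s. weighted_summatory gker a (exp s)) s"
proof -
  define B where "B = (\<lambda>s. summatory a (exp s))"
  define f' where "f' = (\<lambda>s. weighted_summatory gker a (exp s))"
  note k = exp_order_gconv_kernel
  have f'_eq: "f' = (\<lambda>s. B s + conv gconv_kernel B s)"
    by (simp add: f'_def B_def weighted_summatory_eq_conv)
  have f0: "exp_order 0 f'" using f by (simp add: f'_def)
  obtain M where M: "\<And>s. norm (f' s) \<le> M" using exp_orderD(3)[OF f0] by auto
  \<comment> \<open>This a priori growth is what makes the Laplace transform of \<open>B\<close>
    converge somewhere.\<close>
  have B1: "exp_order 1 B"
    unfolding exp_order_def B_def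
  proof (intro conjI exI[of _ M] allI impI)
    show "norm (summatory a (exp s)) \<le> M * exp (1 * s)" if "s \<ge> 0" for s
      using summatory_growth[of a M s] M that by (simp add: f'_def)
  qed (auto simp: measurable_summatory summatory_def nat_floor_exp_neg)
  \<comment> \<open>The factors have order at most 1 and convolution asks for a strictly larger
    order; 2 serves as common abscissa for all transforms.\<close>
  have kB: "exp_order 2 (conv gconv_kernel B)" by (rule exp_order_conv[OF k B1]) auto
  have rf: "exp_order 2 (conv r f')" by (rule exp_order_conv[OF r(2) f0]) (use r(3) in auto)
  have "conv gconv_kernel B s + conv r f' s = 0"
  proof (rule laplace_zero_imp_zero[where p = 2 and \<phi> = "\<lambda>s. conv gconv_kernel B s + conv r f' s"])
    have "continuous_on {0..} gconv_kernel"
    proof (rule continuous_on_eq)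
      show "continuous_on {0..} (\<lambda>s. complex_of_real (2 * logistic s * (1 - logistic s)))"
        by (intro continuous_at_imp_continuous_on ballI continuous_intros)
    qed (auto simp: gconv_kernel_def causal_def)
    thus "continuous_on UNIV (\<lambda>s. conv gconv_kernel B s + conv r f' s)"
      by (intro continuous_on_add continuous_on_conv[OF k B1] continuous_on_conv[OF r(2) f0 r(1)])
    show "exp_order 2 (\<lambda>s. conv gconv_kernel B s + conv r f' s)" by (rule exp_order_add[OF kB rf])
    fix x :: real assume x: "x > 2"
    define w where "w = complex_of_real x"
    have w: "Re w > 2" using x by (simp add: w_def)
    have Lk: "laplace (conv gconv_kernel B) w = laplace gconv_kernel w * laplace B w"
      by (rule laplace_conv[OF k B1]) (use w in auto)
    have Lf: "laplace f' w = (1 + laplace gconv_kernel w) * laplace B w"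
    proof -
      have "laplace f' w = laplace B w + laplace (conv gconv_kernel B) w"
        unfolding f'_eq by (rule laplace_add[OF exp_order_mono[OF B1] kB w]) simp
      thus ?thesis by (simp add: Lk distrib_right)
    qed
    have Lr: "laplace (conv r f') w = laplace r w * laplace f' w"
      by (rule laplace_conv[OF r(2) f0]) (use w r(3) in auto)
    have "\<not> is_pole gstar (- w)"
    proof
      assume "is_pole gstar (- w)"
      then obtain n where "- w = of_nat n" by (auto simp: is_pole_gstar_iff elim: Nats_cases)
      hence "Re (- w) = real n" by simp
      thus False using w by simp
    qed
    moreover from this have "gstar (- w) \<noteq> 0" using nz[of "- w"] w \<alpha> by simp
    moreover have "gstar (- w) = 1 + laplace gconv_kernel w" by (rule gstar_minus_eq_laplace) (use w in auto)
    ultimately have "gstar_recip w * (1 + laplace gconv_kernel w) = 1" by (simp add: gstar_recip_def)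
    hence 1: "(gstar_recip w - 1) * (1 + laplace gconv_kernel w) = - laplace gconv_kernel w" by (simp add: algebra_simps)
    have 2: "laplace r w = gstar_recip w - 1" using w r(3) by (intro r(4)) auto
    have "laplace (conv r f') w = - laplace gconv_kernel w * laplace B w"
      unfolding Lr Lf 2 mult.assoc[symmetric] 1 ..
    thus "laplace (\<lambda>s. conv gconv_kernel B s + conv r f' s) (of_real x) = 0"
      using laplace_add[OF kB rf w] Lk by (simp add: w_def)
  qed
  moreover have "f' s = B s + conv gconv_kernel B s" by (simp add: f'_eq)
  ultimately have "B s = f' s + conv r f' s" by (simp add: add.assoc)
  thus ?thesis by (simp only: B_def f'_def)
qed

text \<open>On \<open>s \<ge> 0\<close> the convolution is \<open>exp (- \<beta> * s)\<close> times
  the integral of \<open>r t * exp (\<beta> * t)\<close> over \<open>[0, s]\<close>. As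
  \<open>\<beta> < \<sigma>\<close>, the full integral converges to
  \<open>laplace r (- \<beta>)\<close>, and the missing tail is
  \<open>O(exp (- (\<sigma> - \<beta>) * s))\<close>. The error thus has order exactly
  \<open>- \<sigma>\<close>, better than the general convolution bound.\<close>

lemma exp_order_conv_exp:
  assumes r: "exp_order (- \<sigma>) r" and \<beta>: "\<beta> < \<sigma>"
  defines "e \<equiv> causal (\<lambda>s. exp (- of_real \<beta> * of_real s))"
  shows "exp_order (- \<sigma>) (\<lambda>s. conv r e s - laplace r (- of_real \<beta>) * e s)"
proof -
  have e_ord: "exp_order (- \<beta>) e"
    unfolding e_def using laplace_exp(1)[of "- of_real \<beta>" "of_real (1 - \<beta>)"] by simp
  note [measurable] = exp_orderD(1)[OF e_ord] exp_orderD(1)[OF r]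
  \<comment> \<open>The order chosen here is deliberately crude; only measurability is extracted
    from it.\<close>
  have conv_meas: "conv r e \<in> borel_measurable borel"
    using exp_orderD(1)[OF exp_order_conv[OF r e_ord, of "\<bar>\<sigma>\<bar> + \<bar>\<beta>\<bar> + 1"]] by linarith
  obtain C where C: "C \<ge> 0" "\<And>s. norm (r s) \<le> C * exp (- \<sigma> * s)" using exp_orderD(3)[OF r] by blast
  define g where "g = (\<lambda>t. r t * exp (of_real \<beta> * of_real t))"
  have g_int: "integrable lborel g"
    unfolding g_def using exp_order_integrable[OF r, of "- of_real \<beta>"] \<beta> by simp
  have g_bd: "norm (g t) \<le> C * exp (- (\<sigma> - \<beta>) * t)" for t
  proof -
    have "norm (g t) \<le> C * exp (- \<sigma> * t) * exp (\<beta> * t)"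
      unfolding g_def norm_mult by (intro mult_mono C) (auto simp: C)
    thus ?thesis by (simp add: algebra_simps flip: exp_add)
  qed
  have "norm (conv r e s - laplace r (- of_real \<beta>) * e s) \<le> C / (\<sigma> - \<beta>) * exp (- \<sigma> * s)" if s: "s \<ge> 0" for s
  proof -
    have e_s: "e s = exp (- of_real \<beta> * of_real s)" using s by (simp add: e_def causal_def)
    have "conv r e s = (\<integral>t. r t * e (s - t) \<partial>lborel)"
      unfolding conv_def
      by (subst lborel_integral_real_affine[where c = "-1" and t = s]) auto
    also have "\<dots> = (\<integral>t. (indicator {..s} t *\<^sub>R g t) * e s \<partial>lborel)"
    proof (intro Bochner_Integration.integral_cong refl)
      fix t
      have "exp (- of_real \<beta> * of_real (s - t)) = exp (of_real \<beta> * of_real t) * exp (- of_real \<beta> * complex_of_real s)"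
        by (simp add: algebra_simps flip: exp_add)
      thus "r t * e (s - t) = (indicator {..s} t *\<^sub>R g t) * e s"
        unfolding e_s by (cases "t \<le> s") (simp_all add: e_def causal_def g_def)
    qed
    also have "\<dots> = (\<integral>t. indicator {..s} t *\<^sub>R g t \<partial>lborel) * e s"
      by (rule integral_mult_left_zero)
    finally have 1: "conv r e s = (\<integral>t. indicator {..s} t *\<^sub>R g t \<partial>lborel) * e s" .
    have i: "integrable lborel (\<lambda>t. indicator {..s} t *\<^sub>R g t)" "integrable lborel (\<lambda>t. indicator {s<..} t *\<^sub>R g t)"
      by (intro integrable_mult_indicator g_int; simp)+
    have "laplace r (- of_real \<beta>) = integral\<^sup>L lborel g" by (simp add: laplace_def g_def)
    also have "\<dots> = (\<integral>t. indicator {..s} t *\<^sub>R g t + indicator {s<..} t *\<^sub>R g t \<partial>lborel)"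
      by (intro Bochner_Integration.integral_cong refl) (auto simp: indicator_def)
    also have "\<dots> = (\<integral>t. indicator {..s} t *\<^sub>R g t \<partial>lborel) + (\<integral>t. indicator {s<..} t *\<^sub>R g t \<partial>lborel)"
      by (rule Bochner_Integration.integral_add[OF i])
    finally have 2: "conv r e s - laplace r (- of_real \<beta>) * e s = - (\<integral>t. indicator {s<..} t *\<^sub>R g t \<partial>lborel) * e s"
      unfolding 1 by (simp add: algebra_simps)
    have hb: "has_bochner_integral lborel (\<lambda>t. C * (indicator {s..} t * exp (- (\<sigma> - \<beta>) * t))) (C * (exp (- (\<sigma> - \<beta>) * s) / (\<sigma> - \<beta>)))"
      by (intro has_bochner_integral_mult_right has_bochner_integral_exp_tail) (use \<beta> in simp)
    have "norm (\<integral>t. indicator {s<..} t *\<^sub>R g t \<partial>lborel) \<le> (\<integral>t. C * (indicator {s..} t * exp (- (\<sigma> - \<beta>) * t)) \<partial>lborel)"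
    proof (rule Bochner_Integration.integral_norm_bound_integral[OF i(2)])
      show "integrable lborel (\<lambda>t. C * (indicator {s..} t * exp (- (\<sigma> - \<beta>) * t)))"
        using hb by (simp only: has_bochner_integral_iff)
      show "norm (indicator {s<..} t *\<^sub>R g t) \<le> C * (indicator {s..} t * exp (- (\<sigma> - \<beta>) * t))" for t
        using g_bd[of t] C(1) by (cases "s < t") auto
    qed
    hence "norm (\<integral>t. indicator {s<..} t *\<^sub>R g t \<partial>lborel) \<le> C * (exp (- (\<sigma> - \<beta>) * s) / (\<sigma> - \<beta>))"
      using hb by (simp only: has_bochner_integral_iff)
    moreover have "norm (e s) = exp (- \<beta> * s)" unfolding e_s by simp
    ultimately have "norm (conv r e s - laplace r (- of_real \<beta>) * e s) \<le> C * (exp (- (\<sigma> - \<beta>) * s) / (\<sigma> - \<beta>)) * exp (- \<beta> * s)"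
      unfolding 2 norm_mult norm_minus_cancel using C(1) \<beta> by (intro mult_mono) auto
    also have "\<dots> = C / (\<sigma> - \<beta>) * exp (- \<sigma> * s)" by (simp add: algebra_simps flip: exp_add)
    finally show ?thesis .
  qed
  moreover have "conv r e s - laplace r (- of_real \<beta>) * e s = 0" if "s < 0" for s
    using exp_orderD(2)[OF exp_order_conv[OF r e_ord, of "\<bar>\<sigma>\<bar> + \<bar>\<beta>\<bar> + 1"] that] exp_orderD(2)[OF e_ord that]
    by simp
  moreover have "(\<lambda>s. conv r e s - laplace r (- of_real \<beta>) * e s) \<in> borel_measurable borel"
    using conv_meas by measurable
  ultimately show ?thesis unfolding exp_order_def by blast
qed

section \<open>Passage between powers of x and exponentials in s\<close>

lemma exp_order_weighted_summatory_error:
  assumes "\<beta> > 0" "c > 0"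
    and O: "(\<lambda>x. weighted_summatory gker a x - \<kappa> * of_real (x powr (- \<beta>))) \<in> O[at_top](\<lambda>x. of_real (x powr (- c)))"
  shows "exp_order (- c) (\<lambda>s. weighted_summatory gker a (exp s) - \<kappa> * causal (\<lambda>s. exp (- of_real \<beta> * of_real s)) s)"
proof -
  define E where "E = (\<lambda>s. weighted_summatory gker a (exp s) - \<kappa> * causal (\<lambda>s. exp (- of_real \<beta> * of_real s)) s)"
  obtain C X0 where C: "\<And>x. x \<ge> X0 \<Longrightarrow> norm (weighted_summatory gker a x - \<kappa> * of_real (x powr (- \<beta>))) \<le> C * norm (complex_of_real (x powr (- c)))"
    using landau_o.bigE[OF O] unfolding eventually_at_top_linorder by metis
  \<comment> \<open>Below \<open>X\<close> the asymptotic hypothesis says nothing, but only finitely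
    many \<open>a n\<close> occur; weights at most 2 and \<open>exp (- \<beta> * s) \<le> 1\<close>
    give the constant \<open>D\<close>. There \<open>exp (- c * s) \<ge> X powr (- c)\<close>, so
    \<open>D * X powr c\<close> absorbs this range.\<close>
  define X where "X = max 1 X0"
  define D where "D = 2 * (\<Sum>n=1..nat \<lfloor>X\<rfloor>. norm (a n)) + norm \<kappa>"
  have E_eq: "E s = weighted_summatory gker a (exp s) - \<kappa> * of_real (exp s powr (- \<beta>))" if "s \<ge> 0" for s
    using that by (simp add: E_def causal_def powr_def flip: exp_of_real)
  have far: "norm (E s) \<le> C * exp (- c * s)" if "s \<ge> 0" "exp s \<ge> X" for s
    using C[of "exp s"] that E_eq[of s] by (simp add: X_def powr_def)
  have near: "norm (E s) \<le> D" if "s \<ge> 0" "exp s \<le> X" for s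
  proof -
    have "norm (weighted_summatory gker a (exp s)) \<le> (\<Sum>n=1..nat \<lfloor>exp s\<rfloor>. norm (a n) * 2)"
      unfolding weighted_summatory_def
    proof (rule sum_norm_le)
      fix n
      have "0 < gker (real n / exp s)" "gker (real n / exp s) \<le> 2"
        by (auto simp: gker_def divide_simps add_pos_nonneg)
      thus "norm (a n * of_real (gker (real n / exp s))) \<le> norm (a n) * 2"
        unfolding norm_mult norm_of_real by (intro mult_left_mono) auto
    qed
    also have "\<dots> \<le> (\<Sum>n=1..nat \<lfloor>X\<rfloor>. norm (a n) * 2)"
      using that by (intro sum_mono2) (auto intro: order_trans nat_mono floor_mono)
    also have "\<dots> = 2 * (\<Sum>n=1..nat \<lfloor>X\<rfloor>. norm (a n))" by (simp add: sum_distrib_left mult.commute)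
    finally have 1: "norm (weighted_summatory gker a (exp s)) \<le> 2 * (\<Sum>n=1..nat \<lfloor>X\<rfloor>. norm (a n))" .
    have "norm (\<kappa> * causal (\<lambda>s. exp (- of_real \<beta> * of_real s)) s) \<le> norm \<kappa> * 1"
      unfolding norm_mult using that assms(1) by (intro mult_left_mono) (auto simp: causal_def)
    thus ?thesis using 1 norm_triangle_ineq4[of "weighted_summatory gker a (exp s)" "\<kappa> * causal (\<lambda>s. exp (- of_real \<beta> * of_real s)) s"]
      by (simp add: E_def D_def)
  qed
  have D: "D \<ge> 0" by (auto simp: D_def intro!: add_nonneg_nonneg sum_nonneg)
  have X: "X > 0" by (simp add: X_def)
  have "norm (E s) \<le> max C (D * X powr c) * exp (- c * s)" if "s \<ge> 0" for s
  proof (cases "exp s \<ge> X")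
    case True
    thus ?thesis using far[OF that True] by (elim order_trans) (auto intro: mult_right_mono)
  next
    case False
    have "1 \<le> X powr c * exp (- c * s)"
    proof -
      have "s \<le> ln X" using False X by (simp add: ln_ge_iff less_imp_le)
      hence "c * s \<le> c * ln X" using assms(2) by (intro mult_left_mono) auto
      hence "0 \<le> c * ln X + - c * s" by simp
      thus ?thesis using X by (simp add: powr_def flip: exp_add)
    qed
    hence "D * 1 \<le> D * (X powr c * exp (- c * s))" by (intro mult_left_mono D)
    moreover have "norm (E s) \<le> D" using near[OF that] False by simp
    ultimately have "norm (E s) \<le> (D * X powr c) * exp (- c * s)" by (simp add: mult.assoc)
    thus ?thesis by (elim order_trans) (auto intro: mult_right_mono)
  qed
  moreover have "E s = 0" if "s < 0" for s
    using that by (simp add: E_def causal_def weighted_summatory_def nat_floor_exp_neg)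
  moreover have "E \<in> borel_measurable borel"
  proof -
    have "causal (\<lambda>s. exp (- of_real \<beta> * of_real s)) \<in> borel_measurable borel"
      using exp_orderD(1)[OF laplace_exp(1)[of "- of_real \<beta>" 0]] assms by simp
    thus ?thesis unfolding E_def using measurable_weighted_summatory by measurable
  qed
  ultimately show ?thesis unfolding exp_order_def E_def by blast
qed

lemma exp_order_imp_bigo:
  assumes "exp_order d (\<lambda>s. summatory a (exp s) - K * causal (\<lambda>s. exp (- of_real \<beta> * of_real s)) s)"
  shows "(\<lambda>x. summatory a x - K * of_real (x powr (- \<beta>))) \<in> O[at_top](\<lambda>x. of_real (x powr d))"
proof -
  obtain C where C: "\<And>s. norm (summatory a (exp s) - K * causal (\<lambda>s. exp (- of_real \<beta> * of_real s)) s) \<le> C * exp (d * s)"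
    using exp_orderD(3)[OF assms] by blast
  show ?thesis
  proof (rule landau_o.bigI)
    have "C * exp (d * 0) \<ge> 0" using order_trans[OF norm_ge_zero C[of 0]] .
    thus "\<bar>C\<bar> + 1 > 0" by simp
    show "eventually (\<lambda>x. norm (summatory a x - K * of_real (x powr (- \<beta>))) \<le> (\<bar>C\<bar> + 1) * norm (complex_of_real (x powr d))) at_top"
      using eventually_ge_at_top[of 1]
    proof eventually_elim
      case (elim x)
      hence x: "exp (ln x) = x" "ln x \<ge> 0" by auto
      have "causal (\<lambda>s. exp (- of_real \<beta> * of_real s)) (ln x) = complex_of_real (x powr (- \<beta>))"
        using x elim by (simp add: causal_def powr_def flip: exp_of_real)
      hence "norm (summatory a x - K * of_real (x powr (- \<beta>))) \<le> C * x powr d"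
        using C[of "ln x"] x elim by (simp add: powr_def)
      also have "\<dots> \<le> (\<bar>C\<bar> + 1) * x powr d" by (intro mult_right_mono) auto
      finally show ?case by simp
    qed
  qed
qed

text \<open>At a positive integer \<beta> the function \<open>gstar\<close> has a pole, so its
  reciprocal is 0 and the main term vanishes. Since the value of \<open>gstar\<close> at a pole
  carries no meaning, this is stated as an explicit case, and the hypothesis on zeros is restricted
  to points that are not poles.\<close>

theorem theorem2p7:
  fixes a :: "nat \<Rightarrow> complex" and \<alpha>\<^sub>1 \<beta> c :: real and \<kappa> :: complex
  assumes "\<alpha>\<^sub>1 > 0"
    and "\<And>z. Re z < \<alpha>\<^sub>1 \<Longrightarrow> \<not> is_pole gstar z \<Longrightarrow> gstar z \<noteq> 0"
    and "\<beta> > 0" and "c > 0"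
    and "(\<lambda>x. weighted_summatory gker a x - \<kappa> * of_real (x powr (- \<beta>)))
           \<in> O[at_top](\<lambda>x. of_real (x powr (- c)))"
  shows "\<forall>\<epsilon>>0.
    (\<beta> < \<alpha>\<^sub>1 \<longrightarrow>
      (\<lambda>x. summatory a x -
             (if is_pole gstar (of_real \<beta>) then 0 else \<kappa> / gstar (of_real \<beta>)) * of_real (x powr (- \<beta>)))
        \<in> O[at_top](\<lambda>x. of_real (x powr (- min c \<alpha>\<^sub>1 + \<epsilon>)))) \<and>
    (\<beta> \<ge> \<alpha>\<^sub>1 \<longrightarrow>
      summatory a \<in> O[at_top](\<lambda>x. of_real (x powr (- min c \<alpha>\<^sub>1 + \<epsilon>))))"
proof (intro allI impI)
  fix \<epsilon> :: real assume \<epsilon>: "\<epsilon> > 0"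
  define d where "d = - min c \<alpha>\<^sub>1 + \<epsilon>"
  \<comment> \<open>\<sigma> will lie strictly between \<open>m\<close> and
    \<open>\<alpha>\<^sub>1\<close>. The entries of \<open>m\<close> secure in turn a decaying
    resolvent, the inequality \<open>- \<sigma> < d\<close>, and, if
    \<open>\<beta> < \<alpha>\<^sub>1\<close>, convergence of \<open>laplace r\<close> at
    \<open>- \<beta>\<close>.\<close>
  define m where "m = max (max 0 (\<alpha>\<^sub>1 - \<epsilon>)) (if \<beta> < \<alpha>\<^sub>1 then \<beta> else 0)"
  define \<sigma> where "\<sigma> = (\<alpha>\<^sub>1 + m) / 2"
  have "m < \<alpha>\<^sub>1" using assms \<epsilon> by (auto simp: m_def)
  moreover have "m \<ge> 0" "m \<ge> \<alpha>\<^sub>1 - \<epsilon>" "\<beta> < \<alpha>\<^sub>1 \<Longrightarrow> m \<ge> \<beta>" by (auto simp: m_def)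
  moreover have "min c \<alpha>\<^sub>1 \<le> \<alpha>\<^sub>1" by simp
  ultimately have \<sigma>: "\<sigma> < \<alpha>\<^sub>1" "\<sigma> > 0" "- \<sigma> < d" "\<beta> < \<alpha>\<^sub>1 \<Longrightarrow> \<beta> < \<sigma>"
    unfolding \<sigma>_def d_def by (simp_all add: field_simps)
  have cd: "- c < d" using \<epsilon> by (auto simp: d_def)
  obtain r where r: "continuous_on {0..} r" "exp_order (- \<sigma>) r"
    "\<And>w. Re w > - \<sigma> \<Longrightarrow> laplace r w = gstar_recip w - 1"
    using resolvent_exists[OF assms(2) \<sigma>(1)] by blast
  define e where "e = causal (\<lambda>s. exp (- of_real \<beta> * of_real s))"
  define f where "f = (\<lambda>s. weighted_summatory gker a (exp s))"
  define E where "E = (\<lambda>s. f s - \<kappa> * e s)"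
  have E: "exp_order (- c) E"
    unfolding E_def e_def f_def by (rule exp_order_weighted_summatory_error[OF assms(3-5)])
  have e: "exp_order (- \<beta>) e"
    unfolding e_def using laplace_exp(1)[of "- of_real \<beta>" 0] assms by simp
  have f_eq: "f = (\<lambda>s. E s + \<kappa> * e s)" by (simp add: E_def)
  have f_ord: "exp_order b f" if "- c \<le> b" "- \<beta> \<le> b" for b
    unfolding f_eq by (intro exp_order_add exp_order_cmult exp_order_mono[OF E] exp_order_mono[OF e] that)
  have f0: "exp_order 0 f" using assms by (intro f_ord) auto
  have B_eq: "summatory a (exp s) = f s + conv r f s" for s
    unfolding f_def by (rule summatory_eq_resolvent[OF assms(2,1) r(1,2) _ r(3)]) (use f0 \<sigma> in \<open>auto simp: f_def\<close>)
  show "(\<beta> < \<alpha>\<^sub>1 \<longrightarrow>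
      (\<lambda>x. summatory a x -
             (if is_pole gstar (of_real \<beta>) then 0 else \<kappa> / gstar (of_real \<beta>)) * of_real (x powr (- \<beta>)))
        \<in> O[at_top](\<lambda>x. of_real (x powr (- min c \<alpha>\<^sub>1 + \<epsilon>)))) \<and>
    (\<beta> \<ge> \<alpha>\<^sub>1 \<longrightarrow>
      summatory a \<in> O[at_top](\<lambda>x. of_real (x powr (- min c \<alpha>\<^sub>1 + \<epsilon>))))"
  proof (intro conjI impI)
    assume "\<beta> < \<alpha>\<^sub>1"
    hence \<beta>: "\<beta> < \<sigma>" by (rule \<sigma>)
    define K where "K = \<kappa> * gstar_recip (- of_real \<beta>)"
    have Lr: "laplace r (- of_real \<beta>) = gstar_recip (- of_real \<beta>) - 1" using \<beta> by (intro r(3)) simp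
    \<comment> \<open>Because \<open>K = \<kappa> * (1 + laplace r (- \<beta>))\<close>, the main
      terms of \<open>f\<close> and of \<open>conv r f\<close> combine to
      \<open>K * e\<close>.\<close>
    have "summatory a (exp s) - K * e s =
        E s + conv r E s + \<kappa> * (conv r e s - laplace r (- of_real \<beta>) * e s)" for s
    proof -
      have "conv r f s = conv r E s + \<kappa> * conv r e s"
        unfolding conv_def f_eq distrib_left
        using conv_integrable[OF r(2) E, of s] conv_integrable[OF r(2) e, of s]
        by (simp add: mult.left_commute)
      thus ?thesis unfolding B_eq K_def Lr by (simp add: f_eq algebra_simps)
    qed
    \<comment> \<open>The term \<open>conv r E\<close> consumes both strict inequalities
      \<open>- \<sigma> < d\<close> and \<open>- c < d\<close>, and with them the
      \<epsilon>.\<close>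
    moreover have "exp_order d (\<lambda>s. E s + conv r E s + \<kappa> * (conv r e s - laplace r (- of_real \<beta>) * e s))"
      using \<sigma> cd
      by (intro exp_order_add exp_order_cmult exp_order_mono[OF E] exp_order_conv[OF r(2) E]
            exp_order_mono[OF exp_order_conv_exp[OF r(2) \<beta>, folded e_def]]) auto
    ultimately have "exp_order d (\<lambda>s. summatory a (exp s) - K * e s)" by simp
    hence "(\<lambda>x. summatory a x - K * of_real (x powr (- \<beta>))) \<in> O[at_top](\<lambda>x. of_real (x powr d))"
      unfolding e_def by (rule exp_order_imp_bigo)
    moreover have "K = (if is_pole gstar (of_real \<beta>) then 0 else \<kappa> / gstar (of_real \<beta>))"
      by (simp add: K_def gstar_recip_def divide_inverse)
    ultimately show "(\<lambda>x. summatory a x -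
             (if is_pole gstar (of_real \<beta>) then 0 else \<kappa> / gstar (of_real \<beta>)) * of_real (x powr (- \<beta>)))
        \<in> O[at_top](\<lambda>x. of_real (x powr (- min c \<alpha>\<^sub>1 + \<epsilon>)))" by (simp only: d_def)
  next
    assume "\<beta> \<ge> \<alpha>\<^sub>1"
    \<comment> \<open>Here \<open>exp (- \<beta> * s)\<close> is itself within the error, so
      \<open>f\<close> is estimated as a whole and the coefficient of the main term is taken to be
      0.\<close>
    hence f: "exp_order (- min c \<alpha>\<^sub>1) f" by (intro f_ord) auto
    have "exp_order d (\<lambda>s. f s + conv r f s)"
      using \<sigma> \<epsilon> by (intro exp_order_add exp_order_mono[OF f] exp_order_conv[OF r(2) f]) (auto simp: d_def)
    hence "exp_order d (\<lambda>s. summatory a (exp s) - 0 * causal (\<lambda>s. exp (- of_real \<beta> * of_real s)) s)"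
      by (simp add: B_eq)
    from exp_order_imp_bigo[OF this]
    show "summatory a \<in> O[at_top](\<lambda>x. of_real (x powr (- min c \<alpha>\<^sub>1 + \<epsilon>)))" by (simp add: d_def)
  qed
qed

end
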